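(* Assume (Increments), (Waiting times), (Integrability), (Full support) and (Growth) as described in the context. Let $\gamma\le0$ and let $\bar v_1^\gamma,\bar v_2^\gamma\in\mathcal{C}_b(\mathcal{S})$ be solutions, with the same constant $\bar\lambda^\gamma\in\mathbb{R}$, to the Bellman equation $$\bar v(\pi)=\sup_{\pi'\in\mathcal{S}}\Big(\ln s(\pi,\pi')-\bar\lambda^\gamma\,\mathbb{E}[\eta_1]+\mu^\gamma\big[\ln\langle \pi',R(\eta_1)\rangle+\bar v(G(\pi',R(\eta_1)))\big]\Big),\qquad \pi\in\mathcal{S},$$ with concave lifts, i.e. such that $\mathcal{W}_{\bar v_1^\gamma}$ and $\mathcal{W}_{\bar v_2^\gamma}$ are concave on $\mathbb{R}^d_+$. Then there exists a constant $D\in\mathbb{R}$ such that $\bar v_1^\gamma\equiv\bar v_2^\gamma+D$ on $\mathcal{S}$.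
   Context: Notation. $d\ge1$; $\langle x,y\rangle$ is the scalar product, $x\cdot y$ the component-wise product on $\mathbb{R}^d$; $\mathbf{1}=(1,\dots,1)$. $\mathcal{S}=\{\pi\in\mathbb{R}^d:\pi_i\ge0,\ \langle\pi,\mathbf{1}\rangle=1\}$, $\mathcal{S}_0=\{\pi\in\mathcal{S}:\pi_i>0\ \forall i\}$; $\mathcal{C}_b(\mathcal{S})$ is the space of bounded continuous real functions on $\mathcal{S}$. $G(x,y):=\frac{x\cdot y}{\langle x,y\rangle}$. Transaction costs. $c_i,h_i\in[0,1)$, $i=1,\dots,d$; $p(x):=\sum_{i=1}^d\max(c_ix_i,-h_ix_i)$; $\bar c:=\max_i\max(c_i,h_i)$; $\bar s:=\frac{1-\bar c}{1+\bar c}$. For $\pi,\pi'\in\mathcal{S}$, $s(\pi,\pi')$ denotes the unique $w>0$ with $w+p(w\pi'-\pi)=1$. Market. $S(t)=(S_1(t),\dots,S_d(t))$, $t\ge0$, is a process of strictly positive prices, $R(t_1,t_2)=(S_i(t_2)/S_i(t_1))_{i}$, $R(t)=R(0,t)$, $r(t)=\ln R(t)$ (component-wise). $(\eta_i)_{i\ge1}$ are i.i.d. $(0,\infty)$-valued random variables, independent of the price process. (Increments): $t\mapsto\ln S(t)$ is right-continuous and has stationary independent increments. (Waiting times): $\mathbb{P}[\eta_i>0]=1$ and $\mathbb{E}[\eta_i]<\infty$. (Integrability): for any $\gamma<0$, $\mathbb{E}[e^{\gamma\min_i r_i(\eta_1)}]<\infty$, and $\mathbb{E}[\max_i r_i(\eta_1)]<\infty$.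 (Full support): for any $\pi\in\mathcal{S}_0$, $t>0$ and any non-empty (relatively) open $C\subset\mathcal{S}$, $\mathbb{P}[G(\pi,R(t))\in C]>0$. (Growth): for any $\gamma\le0$, $i\in\{1,\dots,d\}$ and every $\pi'\in\mathcal{S}$ with $\pi'_i=0$, $$\frac{\mathbb{E}[R_i(\eta_1)\langle\pi',R(\eta_1)\rangle^{\gamma-1}]}{\mathbb{E}[\langle\pi',R(\eta_1)\rangle^{\gamma}]}>\bar s^{\,\gamma-1}(1+C),\qquad C:=\frac{2\Lambda}{\bar s},\quad \Lambda:=\frac{\bar c}{1-\bar c}$$ (the numerator is allowed to be $+\infty$). Entropic utility. $\mu^\gamma[Z]:=\frac1\gamma\ln\mathbb{E}[e^{\gamma Z}]$ for $\gamma<0$ and $\mu^0[Z]:=\mathbb{E}[Z]$. Lift. For $v\in\mathcal{C}_b(\mathcal{S})$: $\mathcal{W}_v(x):=\langle x,\mathbf{1}\rangle e^{v(x/\langle x,\mathbf{1}\rangle)}$ for $x\in\mathbb{R}^d_+\setminus\{\mathbf{0}\}$, $\mathcal{W}_v(\mathbf{0}):=0$. *)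

theory Defs
  imports "HOL-Probability.Probability"
begin

unbundle inner_syntax

text \<open>
  Vectors of \<open>\<real>\<^sup>d\<close> are elements of \<open>real ^ 'd\<close> for an arbitrary finite type \<open>'d\<close>.  On this type
  the library's \<open>1\<close> is the all-ones vector and \<open>x * y\<close> is the component-wise product.
\<close>

definition unit_simplex :: "(real ^ 'd) set" where
  "unit_simplex = {\<pi>. (\<forall>i. 0 \<le> \<pi> $ i) \<and> \<pi> \<bullet> 1 = 1}"

definition unit_simplex_pos :: "(real ^ 'd) set" where
  "unit_simplex_pos = {\<pi> \<in> unit_simplex. \<forall>i. 0 < \<pi> $ i}"

definition Cb_simplex :: "(real ^ 'd \<Rightarrow> real) set" where
  "Cb_simplex = {v. continuous_on unit_simplex v \<and> bounded (v ` unit_simplex)}"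

definition G :: "real ^ 'd \<Rightarrow> real ^ 'd \<Rightarrow> real ^ 'd" where
  "G x y = (x * y) /\<^sub>R (x \<bullet> y)"


section \<open>Transaction costs\<close>

definition cost_rates :: "real ^ 'd \<Rightarrow> real ^ 'd \<Rightarrow> bool" where
  "cost_rates c h \<longleftrightarrow> (\<forall>i. c $ i \<in> {0..<1} \<and> h $ i \<in> {0..<1})"

definition penalty :: "real ^ 'd \<Rightarrow> real ^ 'd \<Rightarrow> real ^ 'd \<Rightarrow> real" where
  "penalty c h x = (\<Sum>i\<in>UNIV. max (c $ i * x $ i) (- h $ i * x $ i))"

definition c_bar :: "real ^ 'd \<Rightarrow> real ^ 'd \<Rightarrow> real" where
  "c_bar c h = Max (range (\<lambda>i. max (c $ i) (h $ i)))"

definition s_bar :: "real ^ 'd \<Rightarrow> real ^ 'd \<Rightarrow> real" where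
  "s_bar c h = (1 - c_bar c h) / (1 + c_bar c h)"

definition shrinkage :: "real ^ 'd \<Rightarrow> real ^ 'd \<Rightarrow> real ^ 'd \<Rightarrow> real ^ 'd \<Rightarrow> real" where
  "shrinkage c h \<pi> \<pi>' = (THE w. 0 < w \<and> w + penalty c h (w *\<^sub>R \<pi>' - \<pi>) = 1)"

lemma shrinkage_ex1:
  fixes c h :: "real ^ 'd"
  assumes ch: "cost_rates c h" and pi: "\<pi> \<in> unit_simplex" and pi': "\<pi>' \<in> unit_simplex"
  shows "\<exists>!w. 0 < w \<and> w + penalty c h (w *\<^sub>R \<pi>' - \<pi>) = 1"
proof -
  define f where "f w = w + penalty c h (w *\<^sub>R \<pi>' - \<pi>)" for w
  have c: "0 \<le> c $ i" "c $ i < 1" and h: "0 \<le> h $ i" "h $ i < 1" for i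
    using ch by (auto simp: cost_rates_def)
  have nonneg: "0 \<le> \<pi> $ i" "0 \<le> \<pi>' $ i" for i
    using pi pi' by (auto simp: unit_simplex_def)
  have sums: "(\<Sum>i\<in>UNIV. \<pi> $ i) = 1" "(\<Sum>i\<in>UNIV. \<pi>' $ i) = 1"
    using pi pi' by (auto simp: unit_simplex_def inner_vec_def)
  have h_sum: "(\<Sum>i\<in>UNIV. h $ i * q $ i) < 1"
    if q: "\<And>i. 0 \<le> q $ i" "(\<Sum>i\<in>UNIV. q $ i) = 1" for q :: "real ^ 'd"
  proof -
    obtain j where j: "q $ j \<noteq> 0"
      using q(2) by (metis sum.neutral zero_neq_one)
    have "(\<Sum>i\<in>UNIV. h $ i * q $ i) < (\<Sum>i\<in>UNIV. q $ i)"
    proof (rule sum_strict_mono_ex1)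
      show "\<forall>i\<in>UNIV. h $ i * q $ i \<le> q $ i"
        using h q(1) by (simp add: mult_left_le_one_le less_imp_le)
      show "\<exists>i\<in>UNIV. h $ i * q $ i < q $ i"
        using h(2)[of j] j q(1)[of j] by (intro bexI[of _ j]) auto
    qed simp
    then show ?thesis using q(2) by simp
  qed
  have mono: "f w1 < f w2" if "w1 < w2" for w1 w2
  proof -
    have step: "max (c $ i * (w1 * \<pi>' $ i - \<pi> $ i)) (- h $ i * (w1 * \<pi>' $ i - \<pi> $ i))
        - (w2 - w1) * (h $ i * \<pi>' $ i)
        \<le> max (c $ i * (w2 * \<pi>' $ i - \<pi> $ i)) (- h $ i * (w2 * \<pi>' $ i - \<pi> $ i))" for i
    proof -
      have le: "w1 * \<pi>' $ i \<le> w2 * \<pi>' $ i"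
        using that nonneg(2)[of i] by (simp add: mult_right_mono)
      have "c $ i * (w1 * \<pi>' $ i - \<pi> $ i) \<le> c $ i * (w2 * \<pi>' $ i - \<pi> $ i)"
        using le c(1)[of i] by (intro mult_left_mono) auto
      moreover have "0 \<le> (w2 - w1) * (h $ i * \<pi>' $ i)"
        using that h(1)[of i] nonneg(2)[of i] by simp
      moreover have "- h $ i * (w1 * \<pi>' $ i - \<pi> $ i) - (w2 - w1) * (h $ i * \<pi>' $ i)
          = - h $ i * (w2 * \<pi>' $ i - \<pi> $ i)"
        by (simp add: algebra_simps)
      ultimately show ?thesis by linarith
    qed
    have "penalty c h (w1 *\<^sub>R \<pi>' - \<pi>) - (w2 - w1) * (\<Sum>i\<in>UNIV. h $ i * \<pi>' $ i)
        \<le> penalty c h (w2 *\<^sub>R \<pi>' - \<pi>)"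
      unfolding penalty_def sum_distrib_left sum_subtractf[symmetric]
      using step by (intro sum_mono) simp
    moreover have "(w2 - w1) * (\<Sum>i\<in>UNIV. h $ i * \<pi>' $ i) < w2 - w1"
      using mult_strict_left_mono[of "\<Sum>i\<in>UNIV. h $ i * \<pi>' $ i" 1 "w2 - w1"]
        that h_sum[of \<pi>'] nonneg sums by simp
    ultimately have "w1 + penalty c h (w1 *\<^sub>R \<pi>' - \<pi>) < w2 + penalty c h (w2 *\<^sub>R \<pi>' - \<pi>)"
      by (smt (verit))
    then show ?thesis unfolding f_def .
  qed
  have "f 0 = (\<Sum>i\<in>UNIV. h $ i * \<pi> $ i)"
    unfolding f_def penalty_def using c(1) h(1) nonneg(1)
    by (auto intro!: sum.cong simp: max_def)
       (smt (verit) mult_nonneg_nonneg)+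
  then have f0: "f 0 < 1" using h_sum[of \<pi>] nonneg sums by simp
  have pen: "0 \<le> penalty c h x" for x
    unfolding penalty_def
  proof (rule sum_nonneg)
    fix i
    show "0 \<le> max (c $ i * x $ i) (- h $ i * x $ i)"
      using c(1)[of i] h(1)[of i]
      by (cases "0 \<le> x $ i") (auto simp: le_max_iff_disj mult_nonneg_nonpos)
  qed
  have f1: "1 \<le> f 1" using pen[of "1 *\<^sub>R \<pi>' - \<pi>"] by (simp add: f_def)
  have "continuous_on {0..1} f"
    unfolding f_def penalty_def by (intro continuous_intros)
  then obtain w where w: "0 \<le> w" "w \<le> 1" "f w = 1"
    using IVT'[of f 0 1 1] f0 f1 by auto
  then have "0 < w" using f0 by (cases "w = 0") auto
  show ?thesis
  proof (rule ex1I[of _ w])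
    show "0 < w \<and> w + penalty c h (w *\<^sub>R \<pi>' - \<pi>) = 1"
      using w \<open>0 < w\<close> by (simp add: f_def)
    fix u assume "0 < u \<and> u + penalty c h (u *\<^sub>R \<pi>' - \<pi>) = 1"
    then have "f u = f w" using w by (simp add: f_def)
    then show "u = w" using mono[of u w] mono[of w u] by (cases u w rule: linorder_cases) auto
  qed
qed


section \<open>The market\<close>

definition log_price :: "(real \<Rightarrow> 'a \<Rightarrow> real ^ 'd) \<Rightarrow> real \<Rightarrow> 'a \<Rightarrow> real ^ 'd" where
  "log_price S t \<omega> = (\<chi> i. ln (S t \<omega> $ i))"

definition price_ratio :: "(real \<Rightarrow> 'a \<Rightarrow> real ^ 'd) \<Rightarrow> real \<Rightarrow> real \<Rightarrow> 'a \<Rightarrow> real ^ 'd" where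
  "price_ratio S t1 t2 \<omega> = (\<chi> i. S t2 \<omega> $ i / S t1 \<omega> $ i)"

abbreviation ratio :: "(real \<Rightarrow> 'a \<Rightarrow> real ^ 'd) \<Rightarrow> real \<Rightarrow> 'a \<Rightarrow> real ^ 'd" where
  "ratio S t \<equiv> price_ratio S 0 t"

definition log_ratio :: "(real \<Rightarrow> 'a \<Rightarrow> real ^ 'd) \<Rightarrow> real \<Rightarrow> 'a \<Rightarrow> real ^ 'd" where
  "log_ratio S t \<omega> = (\<chi> i. ln (ratio S t \<omega> $ i))"

text \<open>
  The waiting times are \<open>\<eta> 1, \<eta> 2, \<dots>\<close>; the value \<open>\<eta> 0\<close> is irrelevant, and so are the values of
  \<open>S\<close> at negative times.  The last conjunct states that the sigma-algebra generated by the whole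
  price process is independent of the one generated by the whole sequence of waiting times
  (\<open>indep_var\<close> is not applicable since the two path spaces have different types).
\<close>

definition market ::
  "'a measure \<Rightarrow> (real \<Rightarrow> 'a \<Rightarrow> real ^ 'd) \<Rightarrow> (nat \<Rightarrow> 'a \<Rightarrow> real) \<Rightarrow> bool" where
  "market M S \<eta> \<longleftrightarrow>
     prob_space M \<and>
     (\<forall>t\<ge>0. S t \<in> borel_measurable M) \<and>
     (\<forall>t\<ge>0. \<forall>\<omega>\<in>space M. \<forall>i. 0 < S t \<omega> $ i) \<and>
     (\<forall>k\<ge>1. \<forall>\<omega>\<in>space M. 0 < \<eta> k \<omega>) \<and>
     prob_space.indep_vars M (\<lambda>_. borel) \<eta> {1..} \<and>
     (\<forall>k\<ge>1. distr M borel (\<eta> k) = distr M borel (\<eta> 1)) \<and>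
     prob_space.indep_set M
       (sets (vimage_algebra (space M) (\<lambda>\<omega>. \<lambda>t\<in>{0..}. S t \<omega>) (\<Pi>\<^sub>M t\<in>{0..}. borel)))
       (sets (vimage_algebra (space M) (\<lambda>\<omega>. \<lambda>k\<in>{1..}. \<eta> k \<omega>) (\<Pi>\<^sub>M k\<in>{1..}. borel)))"

definition increments_assm :: "'a measure \<Rightarrow> (real \<Rightarrow> 'a \<Rightarrow> real ^ 'd) \<Rightarrow> bool" where
  "increments_assm M S \<longleftrightarrow>
     (\<forall>\<omega>\<in>space M. \<forall>t\<ge>0. continuous (at_right t) (\<lambda>t. log_price S t \<omega>)) \<and>
     (\<forall>t\<ge>0. \<forall>u\<ge>0. distr M borel (\<lambda>\<omega>. log_price S (t + u) \<omega> - log_price S t \<omega>)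
                  = distr M borel (\<lambda>\<omega>. log_price S u \<omega> - log_price S 0 \<omega>)) \<and>
     (\<forall>(n::nat) (t::nat \<Rightarrow> real). 0 \<le> t 0 \<and> (\<forall>k<n. t k < t (Suc k)) \<longrightarrow>
        prob_space.indep_vars M (\<lambda>_. borel)
          (\<lambda>k \<omega>. log_price S (t (Suc k)) \<omega> - log_price S (t k) \<omega>) {..<n})"

text \<open>
  A nonnegative random variable has finite expectation iff its \<open>nn_integral\<close> is finite.
  As \<open>ennreal\<close> truncates negative numbers to \<open>0\<close>, the last conjunct of \<open>integrability_assm\<close>
  bounds the expectation of the positive part of the maximal log-ratio, i.e. it says that the
  expectation (whose negative part is finite by the first conjunct) is less than infinity.
\<close>

definition waiting_assm :: "'a measure \<Rightarrow> (nat \<Rightarrow> 'a \<Rightarrow> real) \<Rightarrow> bool" where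
  "waiting_assm M \<eta> \<longleftrightarrow>
     (\<forall>k\<ge>1. measure M {\<omega> \<in> space M. 0 < \<eta> k \<omega>} = 1 \<and>
            (\<integral>\<^sup>+\<omega>. ennreal (\<eta> k \<omega>) \<partial>M) < \<infinity>)"

definition integrability_assm ::
  "'a measure \<Rightarrow> (real \<Rightarrow> 'a \<Rightarrow> real ^ 'd) \<Rightarrow> (nat \<Rightarrow> 'a \<Rightarrow> real) \<Rightarrow> bool" where
  "integrability_assm M S \<eta> \<longleftrightarrow>
     (\<forall>\<gamma><0. (\<integral>\<^sup>+\<omega>. ennreal (exp (\<gamma> * Min (range (\<lambda>i. log_ratio S (\<eta> 1 \<omega>) \<omega> $ i)))) \<partial>M) < \<infinity>) \<and>
     (\<integral>\<^sup>+\<omega>. ennreal (Max (range (\<lambda>i. log_ratio S (\<eta> 1 \<omega>) \<omega> $ i))) \<partial>M) < \<infinity>"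

definition full_support_assm :: "'a measure \<Rightarrow> (real \<Rightarrow> 'a \<Rightarrow> real ^ 'd) \<Rightarrow> bool" where
  "full_support_assm M S \<longleftrightarrow>
     (\<forall>\<pi>\<in>unit_simplex_pos. \<forall>t>0. \<forall>C. openin (top_of_set unit_simplex) C \<and> C \<noteq> {} \<longrightarrow>
        0 < measure M {\<omega> \<in> space M. G \<pi> (ratio S t \<omega>) \<in> C})"

text \<open>
  The quotient of expectations is formed in \<open>ennreal\<close>, so the numerator may be infinite; under
  the integrability assumption the denominator lies strictly between \<open>0\<close> and \<open>\<infinity>\<close>.
\<close>

definition growth_assm ::
  "'a measure \<Rightarrow> real ^ 'd \<Rightarrow> real ^ 'd \<Rightarrow> (real \<Rightarrow> 'a \<Rightarrow> real ^ 'd) \<Rightarrow> (nat \<Rightarrow> 'a \<Rightarrow> real) \<Rightarrow> bool"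
  where
  "growth_assm M c h S \<eta> \<longleftrightarrow>
     (let \<Lambda> = c_bar c h / (1 - c_bar c h); C = 2 * \<Lambda> / s_bar c h in
      \<forall>\<gamma>\<le>0. \<forall>i. \<forall>\<pi>'\<in>unit_simplex. \<pi>' $ i = 0 \<longrightarrow>
        (\<integral>\<^sup>+\<omega>. ennreal (ratio S (\<eta> 1 \<omega>) \<omega> $ i * (\<pi>' \<bullet> ratio S (\<eta> 1 \<omega>) \<omega>) powr (\<gamma> - 1)) \<partial>M)
        / (\<integral>\<^sup>+\<omega>. ennreal ((\<pi>' \<bullet> ratio S (\<eta> 1 \<omega>) \<omega>) powr \<gamma>) \<partial>M)
        > ennreal (s_bar c h powr (\<gamma> - 1) * (1 + C)))"


section \<open>Bellman equation and lift\<close>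

text \<open>Only used for \<open>\<gamma> \<le> 0\<close>.\<close>

definition entropic_utility :: "'a measure \<Rightarrow> real \<Rightarrow> ('a \<Rightarrow> real) \<Rightarrow> real" where
  "entropic_utility M \<gamma> Z =
     (if \<gamma> = 0 then \<integral>\<omega>. Z \<omega> \<partial>M else 1 / \<gamma> * ln (\<integral>\<omega>. exp (\<gamma> * Z \<omega>) \<partial>M))"

text \<open>
  The supremum is taken in \<open>ereal\<close>, so that the equation also asserts that it is finite.
\<close>

definition bellman_solution ::
  "'a measure \<Rightarrow> real ^ 'd \<Rightarrow> real ^ 'd \<Rightarrow> (real \<Rightarrow> 'a \<Rightarrow> real ^ 'd) \<Rightarrow> (nat \<Rightarrow> 'a \<Rightarrow> real) \<Rightarrow>
   real \<Rightarrow> real \<Rightarrow> (real ^ 'd \<Rightarrow> real) \<Rightarrow> bool" where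
  "bellman_solution M c h S \<eta> \<gamma> l v \<longleftrightarrow>
     (\<forall>\<pi>\<in>unit_simplex. ereal (v \<pi>) =
        (SUP \<pi>'\<in>unit_simplex. ereal
          (ln (shrinkage c h \<pi> \<pi>') - l * (\<integral>\<omega>. \<eta> 1 \<omega> \<partial>M)
           + entropic_utility M \<gamma>
               (\<lambda>\<omega>. ln (\<pi>' \<bullet> ratio S (\<eta> 1 \<omega>) \<omega>) + v (G \<pi>' (ratio S (\<eta> 1 \<omega>) \<omega>))))))"

definition nonneg_orthant :: "(real ^ 'd) set" where
  "nonneg_orthant = {x. \<forall>i. 0 \<le> x $ i}"

definition lift :: "(real ^ 'd \<Rightarrow> real) \<Rightarrow> real ^ 'd \<Rightarrow> real" where
  "lift v x = (if x = 0 then 0 else (x \<bullet> 1) * exp (v (x /\<^sub>R (x \<bullet> 1))))"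

end

theory Submission
  imports Defs
begin

text \<open>
  Let \<open>R\<close> be the return over one waiting time.  The random variable in the Bellman equation is
  \<open>ln (lift v (\<pi>' * R))\<close>, so the equation says that \<open>v \<pi>\<close> is, up to a constant, the supremum over
  \<open>\<pi>'\<close> of \<open>ln (shrinkage c h \<pi> \<pi>')\<close> plus the entropic utility of this logarithmic wealth.

  The proof of uniqueness is a maximum principle.  Let \<open>m\<close> be the maximum of \<open>v1 - v2\<close>, attained
  at \<open>a\<close>, and let \<open>p\<close> be optimal for \<open>v1\<close> at \<open>a\<close>.  Using \<open>p\<close> in both equations at \<open>a\<close> cancels
  the transaction cost, and the utility of the wealth of \<open>p\<close> computed with \<open>v1\<close> exceeds the one
  computed with \<open>v2\<close> by at least \<open>m\<close>.  Pathwise, however, the logarithmic wealths differ by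
  \<open>v1 - v2\<close> at the random portfolio \<open>G p R\<close>, hence by at most \<open>m\<close>.  Strict monotonicity of
  the utility forces equality, so \<open>v1 - v2 = m\<close> almost surely at \<open>G p R\<close>
  (\<open>bellman_difference_AE_max\<close>).  If \<open>p\<close> has only positive weights, then by full support the
  portfolio \<open>G p R\<close> enters every open set with positive probability, so by continuity
  \<open>v1 - v2 = m\<close> everywhere (\<open>constant_from_full_support\<close>).

  The work lies in showing that an optimal portfolio has only positive weights
  (\<open>optimal_portfolio_interior\<close>).  If asset \<open>i\<close> is absent from \<open>p\<close>, one sells
  \<open>\<delta> / s_bar\<close> of the portfolio and buys \<open>\<delta>\<close> units of the asset from the proceeds
  (\<open>shrinkage_rebalance\<close>).  The lift of \<open>v1\<close> is concave and homogeneous, hence superadditive, so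
  the new wealth is at least \<open>1 + \<delta> * (Z - 1 / s_bar)\<close> times the old one, where \<open>Z\<close> is the ratio
  of the lifted payoffs of the asset and of \<open>p\<close>.  Optimality for small \<open>\<delta>\<close> bounds the expectation of
  \<open>Z\<close> weighted with the power \<open>\<gamma>\<close> of the old wealth
  (\<open>entropic_first_order_condition\<close>).  A Bellman solution oscillates by at most \<open>- ln s_bar\<close>
  (\<open>value_oscillation\<close>); inserting this bound for \<open>v1\<close> contradicts the growth condition.
\<close>

section \<open>Transaction costs\<close>

lemma c_bar_ge: "c $ i \<le> c_bar c h" "h $ i \<le> c_bar c h"
proof -
  have "max (c $ i) (h $ i) \<le> c_bar c h"
    unfolding c_bar_def by (rule Max_ge) auto
  then show "c $ i \<le> c_bar c h" "h $ i \<le> c_bar c h" by auto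
qed

lemma c_bar_bounds:
  assumes "cost_rates c h"
  shows "0 \<le> c_bar c h" "c_bar c h < 1"
proof -
  show "0 \<le> c_bar c h"
    using c_bar_ge(1)[of c undefined h] assms
    by (auto simp: cost_rates_def intro: order_trans)
  show "c_bar c h < 1"
    unfolding c_bar_def using assms by (subst Max_less_iff) (auto simp: cost_rates_def)
qed

lemma s_bar_bounds:
  assumes "cost_rates c h"
  shows "0 < s_bar c h" "s_bar c h \<le> 1"
  using c_bar_bounds[OF assms] by (auto simp: s_bar_def field_simps)

text \<open>
  \<open>1 / s_bar\<close> is the worst-case price of one unit of an asset that is bought at the rate \<open>c_bar\<close>
  with the proceeds of sales at the same rate.  The constant in the growth condition is at least
  that price, which is how the condition makes an absent asset worth buying.
\<close>

lemma inverse_s_bar_le_growth_threshold: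
  assumes "cost_rates c h"
  shows "1 / s_bar c h \<le> 1 + 2 * (c_bar c h / (1 - c_bar c h)) / s_bar c h"
proof -
  let ?c = "c_bar c h"
  have c: "0 \<le> ?c" "?c < 1" using c_bar_bounds[OF assms] by auto
  have "1 / s_bar c h = 1 + 2 * (?c / (1 - ?c))"
    using c by (simp add: s_bar_def field_simps)
  moreover have "2 * (?c / (1 - ?c)) / 1 \<le> 2 * (?c / (1 - ?c)) / s_bar c h"
    using c s_bar_bounds[OF assms] by (intro divide_left_mono) auto
  ultimately show ?thesis by simp
qed

lemma penalty_nonneg:
  assumes "cost_rates c h"
  shows "0 \<le> penalty c h x"
  unfolding penalty_def
proof (rule sum_nonneg)
  fix i
  show "0 \<le> max (c $ i * x $ i) (- h $ i * x $ i)"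
    using assms by (cases "0 \<le> x $ i")
      (auto simp: cost_rates_def le_max_iff_disj mult_nonneg_nonpos)
qed

lemma penalty_le:
  assumes "cost_rates c h"
  shows "penalty c h x \<le> c_bar c h * (\<Sum>i\<in>UNIV. \<bar>x $ i\<bar>)"
  unfolding penalty_def sum_distrib_left
proof (rule sum_mono)
  fix i
  have *: "c $ i * \<bar>x $ i\<bar> \<le> c_bar c h * \<bar>x $ i\<bar>" "h $ i * \<bar>x $ i\<bar> \<le> c_bar c h * \<bar>x $ i\<bar>"
    by (intro mult_right_mono c_bar_ge abs_ge_zero)+
  have "c $ i * x $ i \<le> c $ i * \<bar>x $ i\<bar>" "h $ i * (- x $ i) \<le> h $ i * \<bar>x $ i\<bar>"
    using assms by (intro mult_left_mono; auto simp: cost_rates_def)+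
  with * show "max (c $ i * x $ i) (- h $ i * x $ i) \<le> c_bar c h * \<bar>x $ i\<bar>"
    by simp
qed

lemma penalty_add_le: "penalty c h (x + y) \<le> penalty c h x + penalty c h y"
  unfolding penalty_def sum.distrib[symmetric]
  by (rule sum_mono) (auto simp: algebra_simps max_def)

lemma continuous_on_penalty [continuous_intros]:
  assumes "continuous_on A f"
  shows "continuous_on A (\<lambda>x. penalty c h (f x))"
  unfolding penalty_def by (intro continuous_intros assms)

lemma inner_one_eq_sum: "x \<bullet> (1 :: real ^ 'd) = (\<Sum>i\<in>UNIV. x $ i)"
  by (simp add: inner_vec_def)

lemma penalty_diff_simplex_le:
  assumes "cost_rates c h" "a \<in> unit_simplex" "b \<in> unit_simplex" "0 \<le> u" "0 \<le> w"
  shows "penalty c h (u *\<^sub>R a - w *\<^sub>R b) \<le> c_bar c h * (u + w)"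
proof -
  have "(\<Sum>i\<in>UNIV. \<bar>(u *\<^sub>R a - w *\<^sub>R b) $ i\<bar>) \<le> (\<Sum>i\<in>UNIV. u * a $ i + w * b $ i)"
    using assms by (intro sum_mono) (auto simp: unit_simplex_def intro!: abs_leI
      intro: order_trans[of _ 0] add_nonneg_nonneg mult_nonneg_nonneg diff_mono
      simp: algebra_simps)
  also have "\<dots> = u + w"
    using assms by (simp add: sum.distrib sum_distrib_left[symmetric] unit_simplex_def inner_one_eq_sum)
  finally show ?thesis
    using penalty_le[OF assms(1), of "u *\<^sub>R a - w *\<^sub>R b"] c_bar_bounds[OF assms(1)]
    by (meson mult_left_mono order_trans)
qed

lemma shrinkage:
  assumes "cost_rates c h" "\<pi> \<in> unit_simplex" "\<pi>' \<in> unit_simplex"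
  shows shrinkage_pos: "0 < shrinkage c h \<pi> \<pi>'"
    and shrinkage_budget: "shrinkage c h \<pi> \<pi>' + penalty c h (shrinkage c h \<pi> \<pi>' *\<^sub>R \<pi>' - \<pi>) = 1"
  using theI'[OF shrinkage_ex1[OF assms]] unfolding shrinkage_def by auto

text \<open>
  Unspent budget can be used to enlarge the target until the budget is exhausted, by the
  intermediate value theorem.  This lets all later estimates work with inequalities in the budget
  constraint instead of with the fixed-point equation for the shrinkage factor.
\<close>

lemma le_shrinkage:
  assumes "cost_rates c h" "\<pi> \<in> unit_simplex" "\<pi>' \<in> unit_simplex"
    and w: "0 < w" "w + penalty c h (w *\<^sub>R \<pi>' - \<pi>) \<le> 1"
  shows "w \<le> shrinkage c h \<pi> \<pi>'"
proof -
  let ?f = "\<lambda>w. w + penalty c h (w *\<^sub>R \<pi>' - \<pi>)"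
  have "w \<le> 1" using w penalty_nonneg[OF assms(1), of "w *\<^sub>R \<pi>' - \<pi>"] by simp
  moreover have "1 \<le> ?f 1" using penalty_nonneg[OF assms(1), of "1 *\<^sub>R \<pi>' - \<pi>"] by simp
  moreover have "continuous_on {w..1} ?f" by (intro continuous_intros)
  ultimately obtain u where u: "w \<le> u" "?f u = 1"
    using IVT'[of ?f w 1 1] w by auto
  with shrinkage_ex1[OF assms(1-3)] shrinkage[OF assms(1-3)] w
  have "u = shrinkage c h \<pi> \<pi>'" by (metis less_le_trans)
  with u show ?thesis by simp
qed

text \<open>
  The lower bound is the wealth that is left after selling the whole portfolio and buying a new one
  from the proceeds, every trade being charged the rate \<open>c_bar\<close>.
\<close>

lemma shrinkage_bounds:
  assumes "cost_rates c h" "\<pi> \<in> unit_simplex" "\<pi>' \<in> unit_simplex"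
  shows "s_bar c h \<le> shrinkage c h \<pi> \<pi>'" "shrinkage c h \<pi> \<pi>' \<le> 1"
proof -
  show "s_bar c h \<le> shrinkage c h \<pi> \<pi>'"
  proof (rule le_shrinkage[OF assms])
    have "penalty c h (s_bar c h *\<^sub>R \<pi>' - \<pi>) \<le> c_bar c h * (s_bar c h + 1)"
      using penalty_diff_simplex_le[OF assms(1,3,2), of "s_bar c h" 1] s_bar_bounds[OF assms(1)]
      by simp
    also have "\<dots> = 1 - s_bar c h"
      using c_bar_bounds[OF assms(1)] by (simp add: s_bar_def field_simps)
    finally show "s_bar c h + penalty c h (s_bar c h *\<^sub>R \<pi>' - \<pi>) \<le> 1" by simp
  qed (use s_bar_bounds[OF assms(1)] in simp)
  show "shrinkage c h \<pi> \<pi>' \<le> 1"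
    using shrinkage_budget[OF assms] penalty_nonneg[OF assms(1), of "shrinkage c h \<pi> \<pi>' *\<^sub>R \<pi>' - \<pi>"]
    by linarith
qed

text \<open>
  The financing side of the perturbation argument.  From the portfolio \<open>\<pi>'\<close> the fraction
  \<open>\<delta> / s_bar\<close> is sold, and the proceeds pay for \<open>\<delta>\<close> units of \<open>b\<close>: with the rate \<open>c_bar\<close> on both
  trades, \<open>(1 + c_bar) * \<delta> = (1 - c_bar) * \<delta> / s_bar\<close>.  Since the penalty is subadditive, doing
  this on top of the trade from \<open>\<pi>\<close> to \<open>\<pi>'\<close> stays within the budget.
\<close>

lemma shrinkage_rebalance:
  assumes ch: "cost_rates c h" and pi: "\<pi> \<in> unit_simplex" "\<pi>' \<in> unit_simplex" "b \<in> unit_simplex"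
    and \<delta>: "0 < \<delta>" "\<delta> < s_bar c h"
  defines "y \<equiv> (1 - \<delta> / s_bar c h) *\<^sub>R \<pi>' + \<delta> *\<^sub>R b"
  shows "0 < y \<bullet> 1" "y /\<^sub>R (y \<bullet> 1) \<in> unit_simplex"
    "shrinkage c h \<pi> \<pi>' * (y \<bullet> 1) \<le> shrinkage c h \<pi> (y /\<^sub>R (y \<bullet> 1))"
proof -
  let ?k = "1 / s_bar c h" and ?s = "shrinkage c h \<pi> \<pi>'" and ?w = "y \<bullet> 1"
  have sb: "0 < s_bar c h" "s_bar c h \<le> 1" by (rule s_bar_bounds[OF ch])+
  have dk: "0 < 1 - \<delta> * ?k" using \<delta> sb by (simp add: field_simps)
  have w: "?w = 1 - \<delta> * ?k + \<delta>"
    using pi by (simp add: y_def inner_add_left unit_simplex_def)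
  then show w0: "0 < ?w" using dk \<delta> by linarith
  have ynn: "0 \<le> y $ i" for i
    using pi dk \<delta> by (auto simp: y_def unit_simplex_def intro!: add_nonneg_nonneg mult_nonneg_nonneg)
  then show S: "y /\<^sub>R ?w \<in> unit_simplex"
    using w0 by (auto simp: unit_simplex_def)
  have s: "0 < ?s" by (rule shrinkage_pos[OF ch pi(1,2)])
  show "?s * ?w \<le> shrinkage c h \<pi> (y /\<^sub>R ?w)"
  proof (rule le_shrinkage[OF ch pi(1) S])
    have e: "(?s * ?w) *\<^sub>R (y /\<^sub>R ?w) - \<pi>
        = (?s *\<^sub>R \<pi>' - \<pi>) + ((?s * \<delta>) *\<^sub>R b - (?s * \<delta> * ?k) *\<^sub>R \<pi>')"
    proof -
      have "(?s * ?w) *\<^sub>R (y /\<^sub>R ?w) = ?s *\<^sub>R y" using w0 by simp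
      then show ?thesis by (simp add: y_def algebra_simps)
    qed
    have "penalty c h ((?s * ?w) *\<^sub>R (y /\<^sub>R ?w) - \<pi>)
        \<le> penalty c h (?s *\<^sub>R \<pi>' - \<pi>) + c_bar c h * (?s * \<delta> + ?s * \<delta> * ?k)"
      unfolding e using s \<delta> sb
      by (intro order_trans[OF penalty_add_le] add_left_mono penalty_diff_simplex_le ch pi) auto
    also have "\<dots> = 1 - ?s + ?s * \<delta> * (c_bar c h * (1 + ?k))"
      using shrinkage_budget[OF ch pi(1,2)] by (simp add: algebra_simps)
    also have "c_bar c h * (1 + ?k) = ?k - 1"
      using c_bar_bounds[OF ch] by (simp add: s_bar_def divide_simps)
    also have "1 - ?s + ?s * \<delta> * (?k - 1) = 1 - ?s * ?w"
      unfolding w by (simp add: algebra_simps)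
    finally show "?s * ?w + penalty c h ((?s * ?w) *\<^sub>R (y /\<^sub>R ?w) - \<pi>) \<le> 1" by simp
  qed (use s w0 in simp)
qed

section \<open>Observing the prices at an independent random time\<close>

text \<open>
  A right-continuous process sampled at a random time is the limit of the same process sampled at
  times rounded up to a grid, and each of the latter takes only countably many values.
\<close>

lemma measurable_right_continuous_at_time:
  fixes f :: "real \<Rightarrow> 'a \<Rightarrow> real ^ 'd"
  assumes f: "\<And>t. 0 \<le> t \<Longrightarrow> f t \<in> borel_measurable N"
    and cont: "\<And>\<omega> t. \<omega> \<in> space N \<Longrightarrow> 0 \<le> t \<Longrightarrow> continuous (at_right t) (\<lambda>t. f t \<omega>)"
    and \<tau>: "\<tau> \<in> borel_measurable N" "\<And>\<omega>. \<omega> \<in> space N \<Longrightarrow> 0 \<le> \<tau> \<omega>"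
  shows "(\<lambda>\<omega>. f (\<tau> \<omega>) \<omega>) \<in> borel_measurable N"
proof (rule borel_measurable_LIMSEQ_metric)
  \<comment> \<open>Rounding by floor plus one lands strictly to the right of the time, also on grid points, so the
    approximations stay inside the filter \<open>at_right\<close>.\<close>
  define \<tau>n where "\<tau>n n x = (of_int \<lfloor>real (Suc n) * x\<rfloor> + 1) / real (Suc n)" for n and x :: real
  \<comment> \<open>The maximum with 0 keeps every member of the countable family measurable, including those with
    a negative index, which the time itself never selects.\<close>
  show "(\<lambda>\<omega>. f (max 0 (\<tau>n n (\<tau> \<omega>))) \<omega>) \<in> borel_measurable N" for n
  proof -
    have "(\<lambda>\<omega>. (\<lambda>i \<omega>. f (max 0 ((of_int i + 1) / real (Suc n))) \<omega>) \<lfloor>real (Suc n) * \<tau> \<omega>\<rfloor> \<omega>)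
        \<in> borel_measurable N"
      by (rule measurable_compose_countable) (use \<tau>(1) f in measurable)
    then show ?thesis by (simp add: \<tau>n_def)
  qed
  fix \<omega> assume \<omega>: "\<omega> \<in> space N"
  have gt: "\<tau> \<omega> < \<tau>n n (\<tau> \<omega>)" for n
    unfolding \<tau>n_def by (subst pos_less_divide_eq) (simp_all add: mult.commute)
  have le: "\<tau>n n (\<tau> \<omega>) \<le> \<tau> \<omega> + 1 / real (Suc n)" for n
  proof -
    have "\<tau>n n (\<tau> \<omega>) \<le> (real (Suc n) * \<tau> \<omega> + 1) / real (Suc n)"
      unfolding \<tau>n_def by (intro divide_right_mono add_right_mono of_int_floor_le) simp
    also have "\<dots> = \<tau> \<omega> + 1 / real (Suc n)" by (simp add: add_divide_distrib)
    finally show ?thesis .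
  qed
  have lim: "(\<lambda>n. \<tau> \<omega> + 1 / real (Suc n)) \<longlonglongrightarrow> \<tau> \<omega>"
    using tendsto_add[OF tendsto_const LIMSEQ_inverse_real_of_nat] by (simp add: inverse_eq_divide)
  have "(\<lambda>n. \<tau>n n (\<tau> \<omega>)) \<longlonglongrightarrow> \<tau> \<omega>"
    by (rule tendsto_sandwich[OF always_eventually always_eventually tendsto_const lim])
      (intro allI less_imp_le gt le)+
  then have "filterlim (\<lambda>n. \<tau>n n (\<tau> \<omega>)) (at_right (\<tau> \<omega>)) sequentially"
    unfolding filterlim_at by (intro conjI always_eventually allI) (use gt in \<open>auto simp: less_imp_neq[THEN not_sym]\<close>)
  moreover have "((\<lambda>t. f t \<omega>) \<longlongrightarrow> f (\<tau> \<omega>) \<omega>) (at_right (\<tau> \<omega>))"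
    using cont[OF \<omega> \<tau>(2)[OF \<omega>]] by (simp add: continuous_within)
  ultimately have "(\<lambda>n. f (\<tau>n n (\<tau> \<omega>)) \<omega>) \<longlonglongrightarrow> f (\<tau> \<omega>) \<omega>"
    by (rule filterlim_compose[rotated])
  moreover have "max 0 (\<tau>n n (\<tau> \<omega>)) = \<tau>n n (\<tau> \<omega>)" for n
    using gt[of n] \<tau>(2)[OF \<omega>] by simp
  ultimately show "(\<lambda>n. f (max 0 (\<tau>n n (\<tau> \<omega>))) \<omega>) \<longlonglongrightarrow> f (\<tau> \<omega>) \<omega>" by simp
qed

lemma borel_measurable_vec_lambda [measurable (raw)]:
  fixes f :: "'d::finite \<Rightarrow> 'a \<Rightarrow> real"
  assumes "\<And>i. f i \<in> borel_measurable N"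
  shows "(\<lambda>\<omega>. \<chi> i. f i \<omega>) \<in> borel_measurable N"
  by (subst borel_measurable_euclidean_space) (auto simp: Basis_vec_def inner_axis assms)

lemma borel_measurable_vec_nth' [measurable (raw)]:
  fixes f :: "'a \<Rightarrow> real ^ 'd"
  assumes "f \<in> borel_measurable N"
  shows "(\<lambda>\<omega>. f \<omega> $ i) \<in> borel_measurable N"
  using measurable_compose[OF assms borel_measurable_nth[of i]] .

lemma measurable_ratio_at_time:
  fixes S :: "real \<Rightarrow> 'a \<Rightarrow> real ^ 'd"
  assumes S: "\<And>t. 0 \<le> t \<Longrightarrow> S t \<in> borel_measurable N"
    and pos: "\<And>\<omega> t i. \<omega> \<in> space N \<Longrightarrow> 0 \<le> t \<Longrightarrow> 0 < S t \<omega> $ i"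
    and cont: "\<And>\<omega> t. \<omega> \<in> space N \<Longrightarrow> 0 \<le> t \<Longrightarrow> continuous (at_right t) (\<lambda>t. log_price S t \<omega>)"
    and \<tau>: "\<tau> \<in> borel_measurable N" "\<And>\<omega>. \<omega> \<in> space N \<Longrightarrow> 0 \<le> \<tau> \<omega>"
  shows "(\<lambda>\<omega>. ratio S (\<tau> \<omega>) \<omega>) \<in> borel_measurable N"
proof -
  have log: "log_price S t \<in> borel_measurable N" if "0 \<le> t" for t
    unfolding log_price_def[abs_def] using S[OF that] by measurable
  have "(\<lambda>\<omega>. log_price S (\<tau> \<omega>) \<omega>) \<in> borel_measurable N"
    by (rule measurable_right_continuous_at_time[OF log cont \<tau>])
  then have "(\<lambda>\<omega>. (\<chi> i. exp (log_price S (\<tau> \<omega>) \<omega> $ i) / S 0 \<omega> $ i) :: real ^ 'd) \<in> borel_measurable N"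
    using S[of 0] by measurable
  then show ?thesis
    by (rule measurable_cong[THEN iffD1, rotated])
       (auto simp: log_price_def price_ratio_def vec_eq_iff pos \<tau>)
qed

text \<open>
  Full support is known at deterministic times, whereas the Bellman equation samples the prices at
  a random one.  Independence turns the joint law of the waiting time and the prices into a product
  measure, and Fubini's theorem then says that an almost sure property at the random time holds
  almost surely at almost every deterministic time.  The second factor of the product is the
  probability space itself with the \<open>\<sigma>\<close>-algebra generated by the prices, which stands in for the
  law of the price process on its path space.
\<close>

lemma AE_ratio_at_fixed_time:
  fixes S :: "real \<Rightarrow> 'a \<Rightarrow> real ^ 'd"
  assumes market: "market M S \<eta>" and incr: "increments_assm M S"
    and P: "{x. P x} \<in> sets borel" and ae: "AE \<omega> in M. P (ratio S (\<eta> 1 \<omega>) \<omega>)"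
  shows "\<exists>t>0. AE \<omega> in M. P (ratio S t \<omega>)"
proof -
  interpret prob_space M using market by (simp add: market_def)
  note One_nat_def [simp del]
  define N where "N = vimage_algebra (space M) (\<lambda>\<omega>. \<lambda>t\<in>{0..}. S t \<omega>) (\<Pi>\<^sub>M t\<in>{0::real..}. borel)"
  define H where "H = vimage_algebra (space M) (\<lambda>\<omega>. \<lambda>k\<in>{1..}. \<eta> k \<omega>) (\<Pi>\<^sub>M k\<in>{1::nat..}. borel)"
  have spN: "space N = space M" by (simp add: N_def)
  have ind: "indep_set (sets N) (sets H)"
    using market by (simp add: market_def N_def H_def)
  have pos: "0 < S t \<omega> $ i" if "\<omega> \<in> space M" "0 \<le> t" for \<omega> t i
    using market that by (simp add: market_def)
  have cont: "continuous (at_right t) (\<lambda>t. log_price S t \<omega>)" if "\<omega> \<in> space M" "0 \<le> t" for \<omega> t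
    using incr that by (simp add: increments_assm_def)
  have \<eta>pos: "0 < \<eta> 1 \<omega>" if "\<omega> \<in> space M" for \<omega>
    using market that by (simp add: market_def)
  have SN: "S t \<in> borel_measurable N" if "0 \<le> t" for t
  proof -
    have "(\<lambda>\<omega>. \<lambda>t\<in>{0..}. S t \<omega>) \<in> N \<rightarrow>\<^sub>M (\<Pi>\<^sub>M t\<in>{0::real..}. borel)"
      unfolding N_def by (rule measurable_vimage_algebra1) (auto simp: space_PiM)
    then have "(\<lambda>\<omega>. (\<lambda>t\<in>{0..}. S t \<omega>) t) \<in> borel_measurable N"
      by (rule measurable_compose) (use that in \<open>auto intro!: measurable_component_singleton\<close>)
    then show ?thesis using that by simp
  qed
  have \<eta>H: "\<eta> 1 \<in> borel_measurable H"
  proof -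
    have "(\<lambda>\<omega>. \<lambda>k\<in>{1..}. \<eta> k \<omega>) \<in> H \<rightarrow>\<^sub>M (\<Pi>\<^sub>M k\<in>{1::nat..}. borel)"
      unfolding H_def by (rule measurable_vimage_algebra1) (auto simp: space_PiM)
    then have "(\<lambda>\<omega>. (\<lambda>k\<in>{1..}. \<eta> k \<omega>) 1) \<in> borel_measurable H"
      by (rule measurable_compose) (auto intro!: measurable_component_singleton)
    then show ?thesis by simp
  qed
  have subN: "sets N \<subseteq> events" and subH: "sets H \<subseteq> events"
    and prod: "\<And>a b. a \<in> sets N \<Longrightarrow> b \<in> sets H \<Longrightarrow> prob (a \<inter> b) = prob a * prob b"
    using ind unfolding indep_sets2_eq by auto
  have idN[measurable]: "(\<lambda>\<omega>. \<omega>) \<in> M \<rightarrow>\<^sub>M N"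
    using subN sets.sets_into_space[of _ N] by (auto simp: measurable_def spN Int_absorb2)
  have \<eta>M[measurable]: "\<eta> 1 \<in> borel_measurable M"
    using \<eta>H subH by (auto simp: measurable_def H_def)
  interpret D1: prob_space "distr M borel (\<eta> 1)" by (rule prob_space_distr) simp
  interpret D2: prob_space "distr M N (\<lambda>\<omega>. \<omega>)" by (rule prob_space_distr) simp
  interpret D: pair_sigma_finite "distr M borel (\<eta> 1)" "distr M N (\<lambda>\<omega>. \<omega>)" ..
  have pair[measurable]: "(\<lambda>\<omega>. (\<eta> 1 \<omega>, \<omega>)) \<in> M \<rightarrow>\<^sub>M borel \<Otimes>\<^sub>M N" by measurable
  have dist: "distr M borel (\<eta> 1) \<Otimes>\<^sub>M distr M N (\<lambda>\<omega>. \<omega>)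
      = distr M (borel \<Otimes>\<^sub>M N) (\<lambda>\<omega>. (\<eta> 1 \<omega>, \<omega>))"
  proof (rule pair_measure_eqI)
    fix A B assume A: "A \<in> sets (distr M borel (\<eta> 1))" and B: "B \<in> sets (distr M N (\<lambda>\<omega>. \<omega>))"
    have AH: "\<eta> 1 -` A \<inter> space M \<in> sets H"
      using measurable_sets[OF \<eta>H, of A] A by (simp add: H_def)
    have BM: "B \<inter> space M = B" using B sets.sets_into_space[of B N] by (auto simp: spN)
    have "emeasure (distr M (borel \<Otimes>\<^sub>M N) (\<lambda>\<omega>. (\<eta> 1 \<omega>, \<omega>))) (A \<times> B)
        = emeasure M ((\<lambda>\<omega>. (\<eta> 1 \<omega>, \<omega>)) -` (A \<times> B) \<inter> space M)"
      using A B by (intro emeasure_distr pair) auto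
    also have "(\<lambda>\<omega>. (\<eta> 1 \<omega>, \<omega>)) -` (A \<times> B) \<inter> space M = B \<inter> (\<eta> 1 -` A \<inter> space M)"
      using BM by auto
    also have "emeasure M \<dots> = emeasure M B * emeasure M (\<eta> 1 -` A \<inter> space M)"
      using prod[of B "\<eta> 1 -` A \<inter> space M"] AH B by (simp add: emeasure_eq_measure ennreal_mult'')
    finally show "emeasure (distr M borel (\<eta> 1)) A * emeasure (distr M N (\<lambda>\<omega>. \<omega>)) B
        = emeasure (distr M (borel \<Otimes>\<^sub>M N) (\<lambda>\<omega>. (\<eta> 1 \<omega>, \<omega>))) (A \<times> B)"
      using A B BM by (simp add: emeasure_distr mult.commute)
  qed (simp_all add: D1.sigma_finite_measure_axioms D2.sigma_finite_measure_axioms cong: sets_pair_measure_cong)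
  \<comment> \<open>The absolute value extends the price ratio to all real times; on the waiting time it is the identity.\<close>
  let ?g = "\<lambda>x. ratio S \<bar>fst x\<bar> (snd x)"
  have "?g = (\<lambda>x. ratio (\<lambda>t x. S t (snd x)) \<bar>fst x\<bar> x)"
    by (simp add: price_ratio_def)
  moreover have "(\<lambda>x. ratio (\<lambda>t x. S t (snd x)) \<bar>fst x\<bar> x) \<in> borel_measurable (borel \<Otimes>\<^sub>M N)"
  proof (rule measurable_ratio_at_time)
    show "(\<lambda>x. S t (snd x)) \<in> borel_measurable (borel \<Otimes>\<^sub>M N)" if "0 \<le> t" for t
      using SN[OF that] by measurable
    show "continuous (at_right t) (\<lambda>t. log_price (\<lambda>t x. S t (snd x)) t x)"
      if "x \<in> space (borel \<Otimes>\<^sub>M N)" "0 \<le> t" for x :: "real \<times> 'a" and t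
      using cont[of "snd x" t] that by (simp add: log_price_def space_pair_measure spN mem_Times_iff)
  qed (auto simp: space_pair_measure spN mem_Times_iff pos)
  ultimately have g[measurable]: "?g \<in> borel_measurable (borel \<Otimes>\<^sub>M N)" by simp
  have Pm: "{x \<in> space K. P (k x)} \<in> sets K" if "k \<in> borel_measurable K" for k :: "'b \<Rightarrow> real ^ 'd" and K
    using measurable_sets[OF that P] by (simp add: vimage_def Int_def conj_commute)
  have "AE \<omega> in M. P (?g (\<eta> 1 \<omega>, \<omega>))"
    using ae AE_space by eventually_elim (use \<eta>pos in \<open>auto simp: less_imp_le\<close>)
  then have "AE x in distr M (borel \<Otimes>\<^sub>M N) (\<lambda>\<omega>. (\<eta> 1 \<omega>, \<omega>)). P (?g x)"
    by (subst AE_distr_iff) (auto intro!: Pm simp del: fst_conv snd_conv)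
  then have "AE t in distr M borel (\<eta> 1). AE \<omega> in distr M N (\<lambda>\<omega>. \<omega>). P (ratio S \<bar>t\<bar> \<omega>)"
    unfolding dist[symmetric] by (drule_tac D.AE_pair) simp
  then have "AE \<omega>' in M. AE \<omega> in distr M N (\<lambda>\<omega>. \<omega>). P (ratio S \<bar>\<eta> 1 \<omega>'\<bar> \<omega>)"
    by (rule AE_distrD[rotated]) simp
  moreover have "AE \<omega>' in M. 0 < \<eta> 1 \<omega>'" using \<eta>pos by (intro AE_I2)
  ultimately have "AE \<omega>' in M. \<exists>t>0. AE \<omega> in distr M N (\<lambda>\<omega>. \<omega>). P (ratio S t \<omega>)"
    by eventually_elim (metis abs_of_pos)
  then have "\<exists>t>0. AE \<omega> in distr M N (\<lambda>\<omega>. \<omega>). P (ratio S t \<omega>)" by simp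
  then show ?thesis by (auto dest: AE_distrD[rotated] intro: idN)
qed

section \<open>Entropic utility\<close>

text \<open>
  The entropic utility is the certainty equivalent of this increasing function.  Comparing certainty
  equivalents through its expectation treats \<open>\<gamma> < 0\<close> and \<open>\<gamma> = 0\<close> by the same argument.
\<close>

definition exp_utility :: "real \<Rightarrow> real \<Rightarrow> real" where
  "exp_utility \<gamma> x = (if \<gamma> = 0 then x else exp (\<gamma> * x) / \<gamma>)"

definition utility_integrable :: "'a measure \<Rightarrow> real \<Rightarrow> ('a \<Rightarrow> real) \<Rightarrow> bool" where
  "utility_integrable M \<gamma> X \<longleftrightarrow>
     X \<in> borel_measurable M \<and> integrable M (\<lambda>\<omega>. exp_utility \<gamma> (X \<omega>))"

lemma exp_utility_strict_mono: "strict_mono (exp_utility \<gamma>)"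
proof (rule strict_monoI)
  fix x y :: real assume "x < y"
  then show "exp_utility \<gamma> x < exp_utility \<gamma> y"
    by (cases "\<gamma> > 0"; cases "\<gamma> = 0") (auto simp: exp_utility_def divide_strict_right_mono divide_strict_right_mono_neg)
qed

lemma exp_utility_le_iff: "exp_utility \<gamma> x \<le> exp_utility \<gamma> y \<longleftrightarrow> x \<le> y"
  by (rule strict_mono_less_eq[OF exp_utility_strict_mono])

lemma exp_utility_add:
  "exp_utility \<gamma> (x + y) = exp_utility \<gamma> x + exp (\<gamma> * x) * (exp_utility \<gamma> y - exp_utility \<gamma> 0)"
  by (cases "\<gamma> = 0") (simp_all add: exp_utility_def distrib_left exp_add field_simps)

lemma utility_integrable_exp:
  assumes "prob_space M" "utility_integrable M \<gamma> X"
  shows "integrable M (\<lambda>\<omega>. exp (\<gamma> * X \<omega>))"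
proof (cases "\<gamma> = 0")
  case True
  interpret prob_space M by fact
  show ?thesis using True by simp
next
  case False
  then have "integrable M (\<lambda>\<omega>. \<gamma> * exp_utility \<gamma> (X \<omega>))"
    using assms(2) unfolding utility_integrable_def by (intro integrable_mult_right) simp
  then show ?thesis using False by (simp add: exp_utility_def)
qed

lemma integral_exp_pos:
  fixes X :: "'a \<Rightarrow> real"
  assumes "prob_space M" "integrable M (\<lambda>\<omega>. exp (X \<omega>))"
  shows "0 < (\<integral>\<omega>. exp (X \<omega>) \<partial>M)"
proof -
  interpret prob_space M by fact
  have "(\<integral>\<omega>. exp (X \<omega>) \<partial>M) \<noteq> 0"
    by (subst integral_nonneg_eq_0_iff_AE[OF assms(2)]) auto
  moreover have "0 \<le> (\<integral>\<omega>. exp (X \<omega>) \<partial>M)" by (intro integral_nonneg_AE) auto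
  ultimately show ?thesis by linarith
qed

lemma utility_integrable_add_const:
  assumes "prob_space M" "utility_integrable M \<gamma> X"
  shows "utility_integrable M \<gamma> (\<lambda>\<omega>. X \<omega> + k)"
  using assms utility_integrable_exp[OF assms] prob_space.finite_measure[OF assms(1)]
  unfolding utility_integrable_def exp_utility_add by (simp add: borel_measurable_add)

lemma exp_utility_entropic_utility:
  assumes "prob_space M" "utility_integrable M \<gamma> X"
  shows "exp_utility \<gamma> (entropic_utility M \<gamma> X) = (\<integral>\<omega>. exp_utility \<gamma> (X \<omega>) \<partial>M)"
  using integral_exp_pos[OF assms(1) utility_integrable_exp[OF assms]]
  by (cases "\<gamma> = 0") (simp_all add: exp_utility_def entropic_utility_def)

lemma entropic_utility_add_const:
  assumes "prob_space M" "utility_integrable M \<gamma> X"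
  shows "entropic_utility M \<gamma> (\<lambda>\<omega>. X \<omega> + k) = entropic_utility M \<gamma> X + k"
proof -
  interpret prob_space M by fact
  show ?thesis
  proof (cases "\<gamma> = 0")
    case True
    then have "integrable M X" using assms(2) by (simp add: utility_integrable_def exp_utility_def)
    with True show ?thesis by (simp add: entropic_utility_def prob_space)
  next
    case False
    with integral_exp_pos[OF assms(1) utility_integrable_exp[OF assms]] show ?thesis
      by (simp add: entropic_utility_def distrib_left exp_add ln_mult field_simps)
  qed
qed

lemma entropic_utility_le_iff:
  assumes "prob_space M" "utility_integrable M \<gamma> X" "utility_integrable M \<gamma> Y"
  shows "entropic_utility M \<gamma> X \<le> entropic_utility M \<gamma> Y \<longleftrightarrow>
    (\<integral>\<omega>. exp_utility \<gamma> (X \<omega>) \<partial>M) \<le> (\<integral>\<omega>. exp_utility \<gamma> (Y \<omega>) \<partial>M)"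
  using exp_utility_le_iff[of \<gamma> "entropic_utility M \<gamma> X" "entropic_utility M \<gamma> Y"]
  by (simp add: exp_utility_entropic_utility assms)

text \<open>
  The utility function is strictly increasing, so a pointwise inequality that is lost on a set of
  positive probability would be lost in expectation as well.
\<close>

lemma entropic_utility_eq_AE:
  assumes M: "prob_space M" and X: "utility_integrable M \<gamma> X" and Y: "utility_integrable M \<gamma> Y"
    and le: "\<And>\<omega>. \<omega> \<in> space M \<Longrightarrow> X \<omega> \<le> Y \<omega>"
    and eu: "entropic_utility M \<gamma> Y \<le> entropic_utility M \<gamma> X"
  shows "AE \<omega> in M. X \<omega> = Y \<omega>"
proof -
  let ?D = "\<lambda>\<omega>. exp_utility \<gamma> (Y \<omega>) - exp_utility \<gamma> (X \<omega>)"
  have int: "integrable M ?D" using X Y by (simp add: utility_integrable_def)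
  have nn: "AE \<omega> in M. 0 \<le> ?D \<omega>" using le by (intro AE_I2) (simp add: exp_utility_le_iff)
  have "(\<integral>\<omega>. ?D \<omega> \<partial>M) \<le> 0"
    using eu X Y by (simp add: entropic_utility_le_iff[OF M Y X] utility_integrable_def)
  with integral_nonneg_AE[OF nn] have "(\<integral>\<omega>. ?D \<omega> \<partial>M) = 0" by linarith
  then have "AE \<omega> in M. ?D \<omega> = 0"
    using integral_nonneg_eq_0_iff_AE[OF int nn] by simp
  then show ?thesis
    by eventually_elim (simp add: strict_mono_eq[OF exp_utility_strict_mono])
qed

text \<open>
  The function \<open>x \<mapsto> exp_utility \<gamma> (ln (1 + x))\<close> has derivative 1 at 0, for every \<open>\<gamma>\<close>.
\<close>

lemma exp_utility_ln_lower_tangent: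
  assumes "0 < e"
  obtains \<rho> where "0 < \<rho>"
    "\<And>x. \<bar>x\<bar> < \<rho> \<Longrightarrow> x - e * \<bar>x\<bar> \<le> exp_utility \<gamma> (ln (1 + x)) - exp_utility \<gamma> 0"
proof -
  let ?f = "\<lambda>x. exp_utility \<gamma> (ln (1 + x))"
  have "(?f has_real_derivative 1) (at 0)"
    by (cases "\<gamma> = 0") (auto simp: exp_utility_def intro!: derivative_eq_intros)
  then have "(?f has_derivative (\<lambda>x. x)) (at 0)"
    unfolding has_field_derivative_def by (rule has_derivative_eq_rhs) auto
  then obtain \<rho> where "0 < \<rho>" and \<rho>: "\<And>x. \<bar>x\<bar> < \<rho> \<Longrightarrow> \<bar>?f x - ?f 0 - x\<bar> \<le> e * \<bar>x\<bar>"
    using assms unfolding has_derivative_at_alt by (auto simp: real_norm_def)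
  show thesis
  proof (rule that[OF \<open>0 < \<rho>\<close>])
    fix x assume "\<bar>x\<bar> < \<rho>"
    from \<rho>[OF this] show "x - e * \<bar>x\<bar> \<le> ?f x - exp_utility \<gamma> 0" by (simp add: abs_le_iff)
  qed
qed

text \<open>
  The derivative of the entropic utility at \<open>\<delta> = 0\<close> along the perturbed wealth
  \<open>exp X0 * (1 + \<delta> * (Z - \<kappa>))\<close>, where \<open>\<kappa>\<close> is the price of the payoff \<open>Z\<close>, is a positive
  multiple of the expectation of \<open>Z - \<kappa>\<close> weighted with \<open>exp (\<gamma> * X0)\<close>, and optimality of \<open>X0\<close> forces
  it to be nonpositive.  Optimality is asked only against some wealth \<open>exp X\<close> above the perturbed
  one, because the wealth of the rebalanced portfolio is only bounded from below by it.
  As \<open>Z\<close> need not be integrable with this weight, the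
  derivative is taken for the bounded payoffs \<open>min Z n\<close> and the bound is carried to \<open>Z\<close> by
  monotone convergence.
\<close>

lemma entropic_first_order_condition:
  assumes M: "prob_space M"
    and X0: "utility_integrable M \<gamma> X0"
    and Z[measurable]: "Z \<in> borel_measurable M" and Z0: "\<And>\<omega>. \<omega> \<in> space M \<Longrightarrow> 0 \<le> Z \<omega>"
    and \<kappa>: "0 < \<kappa>"
    and opt: "\<And>\<delta>. 0 < \<delta> \<Longrightarrow> \<delta> < 1 / \<kappa> \<Longrightarrow> \<exists>X. utility_integrable M \<gamma> X \<and>
      entropic_utility M \<gamma> X \<le> entropic_utility M \<gamma> X0 \<and>
      (\<forall>\<omega>\<in>space M. X0 \<omega> + ln (1 + \<delta> * (Z \<omega> - \<kappa>)) \<le> X \<omega>)"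
  shows "(\<integral>\<^sup>+\<omega>. ennreal (Z \<omega> * exp (\<gamma> * X0 \<omega>)) \<partial>M) \<le> ennreal \<kappa> * (\<integral>\<^sup>+\<omega>. ennreal (exp (\<gamma> * X0 \<omega>)) \<partial>M)"
proof -
  interpret prob_space M by fact
  define q where "q \<omega> = exp (\<gamma> * X0 \<omega>)" for \<omega>
  have q: "integrable M q" unfolding q_def by (rule utility_integrable_exp[OF M X0])
  note [measurable] = borel_measurable_integrable[OF q]
  have Iq: "0 < (\<integral>\<omega>. q \<omega> \<partial>M)" using integral_exp_pos[OF M q[unfolded q_def]] unfolding q_def .
  have q0: "0 < q \<omega>" for \<omega> by (simp add: q_def)
  have trunc: "(\<integral>\<^sup>+\<omega>. ennreal (min (Z \<omega>) (real n) * q \<omega>) \<partial>M) \<le> ennreal \<kappa> * (\<integral>\<^sup>+\<omega>. ennreal (q \<omega>) \<partial>M)" for n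
  proof -
    define Y where "Y \<omega> = min (Z \<omega>) (real n) - \<kappa>" for \<omega>
    have [measurable]: "Y \<in> borel_measurable M" unfolding Y_def by measurable
    define b where "b = real n + \<kappa>"
    have b: "0 < b" using \<kappa> by (simp add: b_def)
    have Yb: "\<bar>Y \<omega>\<bar> \<le> b" "- \<kappa> \<le> Y \<omega>" "Y \<omega> \<le> Z \<omega> - \<kappa>" if "\<omega> \<in> space M" for \<omega>
      using Z0[OF that] \<kappa> by (auto simp: Y_def b_def abs_le_iff min_def)
    have qY: "integrable M (\<lambda>\<omega>. q \<omega> * Y \<omega>)"
    proof (rule Bochner_Integration.integrable_bound)
      show "integrable M (\<lambda>\<omega>. b * q \<omega>)" using q by simp
      show "AE \<omega> in M. norm (q \<omega> * Y \<omega>) \<le> norm (b * q \<omega>)"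
        using Yb(1) q0 b by (intro AE_I2) (simp add: abs_mult mult.commute less_imp_le)
    qed simp
    have bound: "(\<integral>\<omega>. q \<omega> * Y \<omega> \<partial>M) \<le> e * b * (\<integral>\<omega>. q \<omega> \<partial>M)" if e: "0 < e" for e
    proof -
      obtain \<rho> where \<rho>: "0 < \<rho>"
        "\<And>x. \<bar>x\<bar> < \<rho> \<Longrightarrow> x - e * \<bar>x\<bar> \<le> exp_utility \<gamma> (ln (1 + x)) - exp_utility \<gamma> 0"
        using exp_utility_ln_lower_tangent[OF e] by blast
      \<comment> \<open>The step is small enough for the tangent bound on the range of \<open>Y\<close>, and for the perturbed
        wealth to remain positive.\<close>
      define \<delta> where "\<delta> = min (\<rho> / b) (1 / \<kappa>) / 2"
      have \<delta>: "0 < \<delta>" "\<delta> < 1 / \<kappa>" "\<delta> < \<rho> / b"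
        using \<rho>(1) b \<kappa> by (auto simp: \<delta>_def min_def field_simps)
      then have \<delta>': "\<delta> * \<kappa> < 1" "\<delta> * b < \<rho>" using b \<kappa> by (simp_all add: field_simps)
      obtain X where X: "utility_integrable M \<gamma> X" "entropic_utility M \<gamma> X \<le> entropic_utility M \<gamma> X0"
        and XL: "\<And>\<omega>. \<omega> \<in> space M \<Longrightarrow> X0 \<omega> + ln (1 + \<delta> * (Z \<omega> - \<kappa>)) \<le> X \<omega>"
        using opt[OF \<delta>(1,2)] by blast
      have "exp_utility \<gamma> (X0 \<omega>) + \<delta> * (q \<omega> * Y \<omega> - e * b * q \<omega>) \<le> exp_utility \<gamma> (X \<omega>)"
        if \<omega>: "\<omega> \<in> space M" for \<omega>
      proof -
        have "\<delta> * \<bar>Y \<omega>\<bar> \<le> \<delta> * b" using Yb(1)[OF \<omega>] \<delta>(1) by (intro mult_left_mono) auto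
        moreover have "\<bar>\<delta> * Y \<omega>\<bar> = \<delta> * \<bar>Y \<omega>\<bar>" using \<delta>(1) by (simp add: abs_mult)
        ultimately have dY: "\<bar>\<delta> * Y \<omega>\<bar> < \<rho>" using \<delta>'(2) by linarith
        have "- (\<delta> * \<kappa>) \<le> \<delta> * Y \<omega>" using mult_left_mono[OF Yb(2)[OF \<omega>], of \<delta>] \<delta> by simp
        then have pos: "0 < 1 + \<delta> * Y \<omega>" using \<delta>' by linarith
        have "1 + \<delta> * Y \<omega> \<le> 1 + \<delta> * (Z \<omega> - \<kappa>)"
          using Yb(3)[OF \<omega>] \<delta>(1) by (intro add_left_mono mult_left_mono) auto
        then have "ln (1 + \<delta> * Y \<omega>) \<le> ln (1 + \<delta> * (Z \<omega> - \<kappa>))"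
          using pos by simp
        with XL[OF \<omega>] have "X0 \<omega> + ln (1 + \<delta> * Y \<omega>) \<le> X \<omega>" by linarith
        then have "exp_utility \<gamma> (X0 \<omega> + ln (1 + \<delta> * Y \<omega>)) \<le> exp_utility \<gamma> (X \<omega>)"
          by (simp add: exp_utility_le_iff)
        moreover have "q \<omega> * (\<delta> * Y \<omega> - e * (\<delta> * b))
            \<le> q \<omega> * (exp_utility \<gamma> (ln (1 + \<delta> * Y \<omega>)) - exp_utility \<gamma> 0)"
        proof (rule mult_left_mono)
          have "e * \<bar>\<delta> * Y \<omega>\<bar> \<le> e * (\<delta> * b)"
            using Yb(1)[OF \<omega>] \<delta>(1) e by (simp add: abs_mult)
          then show "\<delta> * Y \<omega> - e * (\<delta> * b) \<le> exp_utility \<gamma> (ln (1 + \<delta> * Y \<omega>)) - exp_utility \<gamma> 0"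
            using \<rho>(2)[OF dY] by linarith
        qed (use q0[of \<omega>] in simp)
        ultimately show ?thesis
          unfolding exp_utility_add q_def[symmetric] by (simp add: algebra_simps)
      qed
      then have "(\<integral>\<omega>. exp_utility \<gamma> (X0 \<omega>) + \<delta> * (q \<omega> * Y \<omega> - e * b * q \<omega>) \<partial>M)
          \<le> (\<integral>\<omega>. exp_utility \<gamma> (X \<omega>) \<partial>M)"
        using X(1) X0 q qY by (intro integral_mono) (auto simp: utility_integrable_def)
      also have "\<dots> \<le> (\<integral>\<omega>. exp_utility \<gamma> (X0 \<omega>) \<partial>M)"
        using X(2) by (simp add: entropic_utility_le_iff[OF M X(1) X0])
      finally have "\<delta> * ((\<integral>\<omega>. q \<omega> * Y \<omega> \<partial>M) - e * b * (\<integral>\<omega>. q \<omega> \<partial>M)) \<le> 0"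
        using X0 q qY by (simp add: utility_integrable_def)
      then show ?thesis using \<delta>(1) by (simp add: mult_le_0_iff)
    qed
    have "(\<integral>\<omega>. q \<omega> * Y \<omega> \<partial>M) \<le> 0"
    proof (rule ccontr)
      let ?I = "\<integral>\<omega>. q \<omega> * Y \<omega> \<partial>M" and ?J = "\<integral>\<omega>. q \<omega> \<partial>M"
      assume "\<not> ?I \<le> 0"
      then show False using bound[of "?I / (2 * b * ?J)"] b Iq by (simp add: field_simps)
    qed
    moreover have "min (Z \<omega>) (real n) * q \<omega> = q \<omega> * Y \<omega> + \<kappa> * q \<omega>" for \<omega>
      by (simp add: Y_def algebra_simps)
    ultimately have le: "(\<integral>\<omega>. min (Z \<omega>) (real n) * q \<omega> \<partial>M) \<le> \<kappa> * (\<integral>\<omega>. q \<omega> \<partial>M)"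
      and int: "integrable M (\<lambda>\<omega>. min (Z \<omega>) (real n) * q \<omega>)"
      using q qY by simp_all
    have "(\<integral>\<^sup>+\<omega>. ennreal (min (Z \<omega>) (real n) * q \<omega>) \<partial>M)
        = ennreal (\<integral>\<omega>. min (Z \<omega>) (real n) * q \<omega> \<partial>M)"
      using Z0 q0 by (intro nn_integral_eq_integral int AE_I2) (simp add: less_imp_le)
    also have "\<dots> \<le> ennreal (\<kappa> * (\<integral>\<omega>. q \<omega> \<partial>M))" using le by (rule ennreal_leI)
    also have "\<dots> = ennreal \<kappa> * (\<integral>\<^sup>+\<omega>. ennreal (q \<omega>) \<partial>M)"
      using \<kappa> q q0 Iq by (subst nn_integral_eq_integral) (auto simp: ennreal_mult less_imp_le)
    finally show ?thesis .
  qed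
  have "(\<integral>\<^sup>+\<omega>. ennreal (Z \<omega> * q \<omega>) \<partial>M) = (\<integral>\<^sup>+\<omega>. (SUP n. ennreal (min (Z \<omega>) (real n) * q \<omega>)) \<partial>M)"
  proof (rule nn_integral_cong)
    fix \<omega> assume \<omega>: "\<omega> \<in> space M"
    obtain n where "Z \<omega> \<le> real n" using real_arch_simple by blast
    then show "ennreal (Z \<omega> * q \<omega>) = (SUP n. ennreal (min (Z \<omega>) (real n) * q \<omega>))"
      using q0[of \<omega>] by (intro antisym SUP_upper2[of n] SUP_least ennreal_leI mult_right_mono) (auto simp: min_def)
  qed
  also have "\<dots> = (SUP n. \<integral>\<^sup>+\<omega>. ennreal (min (Z \<omega>) (real n) * q \<omega>) \<partial>M)"
    using q0 by (intro nn_integral_monotone_convergence_SUP)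
      (auto simp: incseq_def le_fun_def less_imp_le intro!: ennreal_leI mult_right_mono)
  also have "\<dots> \<le> ennreal \<kappa> * (\<integral>\<^sup>+\<omega>. ennreal (q \<omega>) \<partial>M)" by (rule SUP_least) (rule trunc)
  finally show ?thesis unfolding q_def .
qed

section \<open>Terminal wealth and its lift\<close>

text \<open>
  The random variable in the Bellman equation as a function of the return vector \<open>x\<close>.
\<close>

definition log_wealth :: "(real ^ 'd \<Rightarrow> real) \<Rightarrow> real ^ 'd \<Rightarrow> real ^ 'd \<Rightarrow> real" where
  "log_wealth v p x = ln (p \<bullet> x) + v (G p x)"

lemma closed_nonneg_coord: "closed {\<pi> :: real ^ 'd. \<forall>i. 0 \<le> \<pi> $ i}"
proof -
  have "closed {\<pi> :: real ^ 'd. 0 \<le> \<pi> $ i}" for i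
    by (intro closed_Collect_le continuous_intros)
  then have "closed (\<Inter>i. {\<pi> :: real ^ 'd. 0 \<le> \<pi> $ i})" by blast
  then show ?thesis by (simp add: INT_simps Collect_all_eq)
qed

lemma compact_unit_simplex: "compact (unit_simplex :: (real ^ 'd) set)"
proof -
  have "closed {\<pi> :: real ^ 'd. \<pi> \<bullet> 1 = 1}"
    by (intro closed_Collect_eq continuous_intros)
  then have "closed (unit_simplex :: (real ^ 'd) set)"
    using closed_Int[OF closed_nonneg_coord] by (simp add: unit_simplex_def Collect_conj_eq)
  moreover have "norm \<pi> \<le> 1" if "\<pi> \<in> unit_simplex" for \<pi> :: "real ^ 'd"
    using norm_le_l1_cart[of \<pi>] that by (simp add: unit_simplex_def inner_one_eq_sum)
  ultimately show ?thesis
    unfolding compact_eq_bounded_closed bounded_iff by blast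
qed

lemma axis_in_unit_simplex: "axis i 1 \<in> unit_simplex"
  by (simp add: unit_simplex_def inner_axis', simp add: axis_def)

lemma unit_simplex_nonempty: "unit_simplex \<noteq> ({} :: (real ^ 'd) set)"
  using axis_in_unit_simplex by blast

lemma inner_between:
  assumes p: "p \<in> unit_simplex" and x: "\<And>i. 0 < x $ i"
  shows "exp (Min (range (\<lambda>i. ln (x $ i)))) \<le> p \<bullet> x"
    and "p \<bullet> x \<le> exp (Max (range (\<lambda>i. ln (x $ i))))"
proof -
  have p0: "0 \<le> p $ i" for i using p by (simp add: unit_simplex_def)
  have p1: "(\<Sum>i\<in>UNIV. p $ i * t) = t" for t
    using p by (simp add: unit_simplex_def inner_one_eq_sum sum_distrib_right[symmetric])
  have lo: "exp (Min (range (\<lambda>i. ln (x $ i)))) \<le> x $ i" for i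
  proof -
    have "Min (range (\<lambda>i. ln (x $ i))) \<le> ln (x $ i)" by (rule Min_le) auto
    then show ?thesis using x[of i] by (simp add: ln_ge_iff)
  qed
  have hi: "x $ i \<le> exp (Max (range (\<lambda>i. ln (x $ i))))" for i
  proof -
    have "ln (x $ i) \<le> Max (range (\<lambda>i. ln (x $ i)))" by (rule Max_ge) auto
    then show ?thesis using x[of i] by (metis exp_le_cancel_iff exp_ln)
  qed
  show "exp (Min (range (\<lambda>i. ln (x $ i)))) \<le> p \<bullet> x"
    unfolding inner_vec_def inner_real_def using lo p0
    by (subst p1[symmetric]) (intro sum_mono mult_left_mono)
  show "p \<bullet> x \<le> exp (Max (range (\<lambda>i. ln (x $ i))))"
    unfolding inner_vec_def inner_real_def using hi p0
    by (subst (2) p1[symmetric]) (intro sum_mono mult_left_mono)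
qed

lemma inner_simplex_pos:
  assumes "p \<in> unit_simplex" "\<And>i. 0 < x $ i"
  shows "0 < p \<bullet> x"
  using inner_between(1)[OF assms] exp_gt_zero less_le_trans by blast

lemma mult_inner_one: "(p * x) \<bullet> 1 = p \<bullet> (x :: real ^ 'd)"
  by (simp add: inner_vec_def)

lemma G_in_unit_simplex:
  assumes p: "p \<in> unit_simplex" and x: "\<And>i. 0 < x $ i"
  shows "G p x \<in> unit_simplex"
  using inner_simplex_pos[OF assms] p x
  by (auto simp: unit_simplex_def G_def mult_inner_one less_imp_le)

text \<open>
  The logarithm in the Bellman equation is that of a function of the unnormalised portfolio
  \<open>p * x\<close>, on which concavity can be used.
\<close>

lemma exp_log_wealth:
  assumes "p \<in> unit_simplex" "\<And>i. 0 < x $ i"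
  shows "exp (log_wealth v p x) = lift v (p * x)"
proof -
  have pos: "0 < p \<bullet> x" by (rule inner_simplex_pos[OF assms])
  then have "p * x \<noteq> 0" using mult_inner_one[of p x] by auto
  then show ?thesis
    using pos by (simp add: log_wealth_def lift_def mult_inner_one G_def exp_add)
qed

lemma lift_scaleR: "lift v (t *\<^sub>R x) = t * lift v x"
proof (cases "t = 0 \<or> x \<bullet> 1 = 0")
  case False
  have "inverse (t * (x \<bullet> 1)) * t = inverse (x \<bullet> 1)"
    using False by (simp add: field_simps)
  then have normalized: "(t *\<^sub>R x) /\<^sub>R ((t *\<^sub>R x) \<bullet> 1) = x /\<^sub>R (x \<bullet> 1)"
    by simp
  show ?thesis
    unfolding lift_def normalized using False by auto
qed (auto simp: lift_def)

text \<open>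
  Concavity together with homogeneity of degree one.
\<close>

lemma lift_superadditive:
  assumes conc: "concave_on nonneg_orthant (lift v)"
    and a: "\<And>i. 0 \<le> a $ i" and b: "\<And>i. 0 \<le> b $ i"
  shows "lift v a + lift v b \<le> lift v (a + b)"
proof -
  have "(1 - 1 / 2) * lift v a + 1 / 2 * lift v b \<le> lift v ((1 - 1 / 2) *\<^sub>R a + (1 / 2) *\<^sub>R b)"
    using a b by (intro concave_onD[OF conc]) (auto simp: nonneg_orthant_def)
  also have "(1 - 1 / 2) *\<^sub>R a + (1 / 2) *\<^sub>R b = (1 / 2) *\<^sub>R (a + b)"
    by (simp add: scaleR_add_right)
  finally show ?thesis by (simp add: lift_scaleR)
qed

text \<open>
  The payoff side of the perturbation argument.  The quantities \<open>s\<close> and \<open>t\<close> count unnormalised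
  holdings, and the term \<open>ln (y \<bullet> 1)\<close> undoes the normalisation of the mixture to a portfolio.
\<close>

lemma log_wealth_mix:
  assumes conc: "concave_on nonneg_orthant (lift v)"
    and p: "p \<in> unit_simplex" and b: "b \<in> unit_simplex" and x: "\<And>i. 0 < x $ i"
    and st: "0 \<le> s" "0 \<le> t"
  defines "y \<equiv> s *\<^sub>R p + t *\<^sub>R b"
  assumes w: "0 < y \<bullet> 1" "y /\<^sub>R (y \<bullet> 1) \<in> unit_simplex"
  shows "s * exp (log_wealth v p x) + t * exp (log_wealth v b x)
    \<le> exp (log_wealth v (y /\<^sub>R (y \<bullet> 1)) x + ln (y \<bullet> 1))"
proof -
  have nn: "0 \<le> (r *\<^sub>R (q * x)) $ i" if "0 \<le> r" "q \<in> unit_simplex" for r q i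
    using that x[of i] by (simp add: unit_simplex_def)
  have "s * exp (log_wealth v p x) + t * exp (log_wealth v b x)
      = lift v (s *\<^sub>R (p * x)) + lift v (t *\<^sub>R (b * x))"
    by (simp add: lift_scaleR exp_log_wealth p b x)
  also have "\<dots> \<le> lift v (s *\<^sub>R (p * x) + t *\<^sub>R (b * x))"
    by (intro lift_superadditive conc nn st p b)
  also have "s *\<^sub>R (p * x) + t *\<^sub>R (b * x) = (y \<bullet> 1) *\<^sub>R ((y /\<^sub>R (y \<bullet> 1)) * x)"
    using w(1) by (simp add: y_def distrib_right)
  also have "lift v \<dots> = (y \<bullet> 1) * exp (log_wealth v (y /\<^sub>R (y \<bullet> 1)) x)"
    using w by (simp only: lift_scaleR exp_log_wealth[OF w(2) x])
  finally show ?thesis using w(1) by (simp add: exp_add mult.commute)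
qed

text \<open>
  The Bellman equation involves the prices only through the return \<open>R\<close> over one waiting time.
  The locale isolates that return from the continuous-time model.
\<close>

locale one_period_market = prob_space M for M :: "'a measure" +
  fixes R :: "'a \<Rightarrow> real ^ 'd" and \<gamma> :: real
  assumes R_measurable [measurable]: "R \<in> borel_measurable M"
    and R_pos: "\<And>\<omega> i. \<omega> \<in> space M \<Longrightarrow> 0 < R \<omega> $ i"
    and \<gamma>_nonpos: "\<gamma> \<le> 0"
    and min_integrable:
      "\<And>\<beta>. \<beta> < 0 \<Longrightarrow> (\<integral>\<^sup>+\<omega>. ennreal (exp (\<beta> * Min (range (\<lambda>i. ln (R \<omega> $ i))))) \<partial>M) < \<infinity>"
    and max_integrable: "(\<integral>\<^sup>+\<omega>. ennreal (Max (range (\<lambda>i. ln (R \<omega> $ i)))) \<partial>M) < \<infinity>"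
begin

definition certainty_equivalent :: "(real ^ 'd \<Rightarrow> real) \<Rightarrow> real ^ 'd \<Rightarrow> real" where
  "certainty_equivalent v p = entropic_utility M \<gamma> (\<lambda>\<omega>. log_wealth v p (R \<omega>))"

lemma log_wealth_measurable:
  assumes v: "v \<in> Cb_simplex" and p: "p \<in> unit_simplex"
  shows "(\<lambda>\<omega>. log_wealth v p (R \<omega>)) \<in> borel_measurable M"
proof -
  have [measurable]: "(\<lambda>x. indicator unit_simplex x *\<^sub>R v x) \<in> borel_measurable borel"
    using v compact_imp_closed[OF compact_unit_simplex]
    by (intro borel_measurable_continuous_on_indicator borel_closed) (auto simp: Cb_simplex_def)
  have [measurable]: "(\<lambda>\<omega>. G p (R \<omega>)) \<in> borel_measurable M"
  proof -
    have "(\<lambda>\<omega>. (\<chi> i. p $ i * R \<omega> $ i) :: real ^ 'd) \<in> borel_measurable M" by measurable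
    then show ?thesis unfolding G_def times_vec_def by measurable
  qed
  have "(\<lambda>\<omega>. ln (p \<bullet> R \<omega>) + indicator unit_simplex (G p (R \<omega>)) *\<^sub>R v (G p (R \<omega>)))
      \<in> borel_measurable M"
    by measurable
  then show ?thesis
    by (rule measurable_cong[THEN iffD1, rotated])
      (simp add: log_wealth_def G_in_unit_simplex[OF p R_pos])
qed

text \<open>
  The return of every portfolio lies between the smallest and the largest return of an asset.  Hence
  one integrable function dominates the utility for all portfolios simultaneously: a negative
  exponential moment of the minimum for \<open>\<gamma> < 0\<close>, and for \<open>\<gamma> = 0\<close> the positive part of the maximum
  together with a bound on the negative part of the minimum.
\<close>

lemma exp_utility_log_wealth_dominated:
  assumes v: "v \<in> Cb_simplex"
  obtains w where "integrable M w"
    "\<And>p \<omega>. p \<in> unit_simplex \<Longrightarrow> \<omega> \<in> space M \<Longrightarrow> \<bar>exp_utility \<gamma> (log_wealth v p (R \<omega>))\<bar> \<le> w \<omega>"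
proof -
  define rmin where "rmin \<omega> = Min (range (\<lambda>i. ln (R \<omega> $ i)))" for \<omega>
  define rmax where "rmax \<omega> = Max (range (\<lambda>i. ln (R \<omega> $ i)))" for \<omega>
  have [measurable]: "rmin \<in> borel_measurable M" "rmax \<in> borel_measurable M"
    unfolding rmin_def rmax_def by measurable
  obtain K where K: "\<And>x. x \<in> unit_simplex \<Longrightarrow> \<bar>v x\<bar> \<le> K"
    using v by (auto simp: Cb_simplex_def bounded_iff)
  have lw: "rmin \<omega> - K \<le> log_wealth v p (R \<omega>)" "log_wealth v p (R \<omega>) \<le> rmax \<omega> + K"
    if "p \<in> unit_simplex" "\<omega> \<in> space M" for p \<omega>
  proof -
    have pos: "0 < p \<bullet> R \<omega>" by (rule inner_simplex_pos[OF that(1) R_pos[OF that(2)]])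
    have "rmin \<omega> \<le> ln (p \<bullet> R \<omega>)"
      using inner_between(1)[OF that(1) R_pos[OF that(2)]] pos by (simp add: ln_ge_iff rmin_def)
    moreover have "ln (p \<bullet> R \<omega>) \<le> rmax \<omega>"
      using inner_between(2)[OF that(1) R_pos[OF that(2)]] pos
      by (metis exp_le_cancel_iff exp_ln rmax_def)
    ultimately show "rmin \<omega> - K \<le> log_wealth v p (R \<omega>)" "log_wealth v p (R \<omega>) \<le> rmax \<omega> + K"
      using K[OF G_in_unit_simplex[OF that(1) R_pos[OF that(2)]]]
      by (auto simp: log_wealth_def abs_le_iff)
  qed
  have min_int: "integrable M (\<lambda>\<omega>. exp (\<beta> * rmin \<omega>))" if "\<beta> < 0" for \<beta>
    using min_integrable[OF that] by (intro integrableI_bounded) (simp_all add: rmin_def)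
  show thesis
  proof (cases "\<gamma> = 0")
    case True
    show thesis
    proof (rule that)
      have "integrable M (\<lambda>\<omega>. max 0 (rmax \<omega>))"
        using max_integrable by (intro integrableI_bounded) (simp_all add: rmax_def ennreal_max_0')
      then show "integrable M (\<lambda>\<omega>. exp (-1 * rmin \<omega>) + max 0 (rmax \<omega>) + K)"
        using min_int[of "-1"] by (intro Bochner_Integration.integrable_add) auto
      fix p :: "real ^ 'd" and \<omega> assume *: "p \<in> unit_simplex" "\<omega> \<in> space M"
      have "- rmin \<omega> \<le> exp (-1 * rmin \<omega>)" "0 \<le> exp (-1 * rmin \<omega>)"
        "0 \<le> max 0 (rmax \<omega>)" "rmax \<omega> \<le> max 0 (rmax \<omega>)"
        using exp_ge_add_one_self[of "- rmin \<omega>"] by auto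
      moreover have "exp_utility \<gamma> (log_wealth v p (R \<omega>)) = log_wealth v p (R \<omega>)"
        using True by (simp add: exp_utility_def)
      ultimately show "\<bar>exp_utility \<gamma> (log_wealth v p (R \<omega>))\<bar> \<le> exp (-1 * rmin \<omega>) + max 0 (rmax \<omega>) + K"
        using lw[OF *] by linarith
    qed
  next
    case False
    then have neg: "\<gamma> < 0" using \<gamma>_nonpos by simp
    show thesis
    proof (rule that)
      show "integrable M (\<lambda>\<omega>. exp (- \<gamma> * K) * exp (\<gamma> * rmin \<omega>) / (- \<gamma>))"
        using min_int[OF neg] by (intro integrable_divide integrable_mult_right) auto
      fix p :: "real ^ 'd" and \<omega> assume *: "p \<in> unit_simplex" "\<omega> \<in> space M"
      have "exp (\<gamma> * log_wealth v p (R \<omega>)) \<le> exp (\<gamma> * (rmin \<omega> - K))"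
        using lw(1)[OF *] neg by simp
      also have "\<dots> = exp (- \<gamma> * K) * exp (\<gamma> * rmin \<omega>)"
        by (simp add: exp_add[symmetric] algebra_simps)
      finally show "\<bar>exp_utility \<gamma> (log_wealth v p (R \<omega>))\<bar> \<le> exp (- \<gamma> * K) * exp (\<gamma> * rmin \<omega>) / (- \<gamma>)"
        using neg by (simp add: exp_utility_def abs_divide divide_right_mono_neg)
    qed
  qed
qed

lemma log_wealth_utility_integrable:
  assumes "v \<in> Cb_simplex" "p \<in> unit_simplex"
  shows "utility_integrable M \<gamma> (\<lambda>\<omega>. log_wealth v p (R \<omega>))"
proof -
  note [measurable] = log_wealth_measurable[OF assms]
  obtain w where w: "integrable M w"
    "\<And>p \<omega>. p \<in> unit_simplex \<Longrightarrow> \<omega> \<in> space M \<Longrightarrow> \<bar>exp_utility \<gamma> (log_wealth v p (R \<omega>))\<bar> \<le> w \<omega>"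
    using exp_utility_log_wealth_dominated[OF assms(1)] by blast
  have "integrable M (\<lambda>\<omega>. exp_utility \<gamma> (log_wealth v p (R \<omega>)))"
  proof (rule Bochner_Integration.integrable_bound[OF w(1)])
    show "(\<lambda>\<omega>. exp_utility \<gamma> (log_wealth v p (R \<omega>))) \<in> borel_measurable M"
      unfolding exp_utility_def by measurable
    show "AE \<omega> in M. norm (exp_utility \<gamma> (log_wealth v p (R \<omega>))) \<le> norm (w \<omega>)"
      using w(2)[OF assms(2)] by (intro AE_I2) (simp add: order_trans[OF _ abs_ge_self])
  qed
  then show ?thesis by (simp add: utility_integrable_def)
qed

lemma continuous_on_certainty_equivalent:
  assumes v: "v \<in> Cb_simplex"
  shows "continuous_on unit_simplex (certainty_equivalent v)"
proof -
  let ?E = "\<lambda>p. \<integral>\<omega>. exp_utility \<gamma> (log_wealth v p (R \<omega>)) \<partial>M"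
  obtain w where w: "integrable M w"
    "\<And>p \<omega>. p \<in> unit_simplex \<Longrightarrow> \<omega> \<in> space M \<Longrightarrow> \<bar>exp_utility \<gamma> (log_wealth v p (R \<omega>))\<bar> \<le> w \<omega>"
    using exp_utility_log_wealth_dominated[OF v] by blast
  have pathwise: "continuous_on unit_simplex (\<lambda>p. exp_utility \<gamma> (log_wealth v p (R \<omega>)))"
    if \<omega>: "\<omega> \<in> space M" for \<omega>
  proof -
    have "continuous_on unit_simplex (\<lambda>p. p * R \<omega>)"
      unfolding times_vec_def by (intro continuous_intros)
    then have G: "continuous_on unit_simplex (\<lambda>p. G p (R \<omega>))"
      unfolding G_def using inner_simplex_pos[OF _ R_pos[OF \<omega>]]
      by (intro continuous_intros) force
    have "continuous_on unit_simplex (\<lambda>p. v (G p (R \<omega>)))"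
      using v G_in_unit_simplex[OF _ R_pos[OF \<omega>]]
      by (intro continuous_on_compose2[OF _ G]) (auto simp: Cb_simplex_def)
    then have "continuous_on unit_simplex (\<lambda>p. log_wealth v p (R \<omega>))"
      unfolding log_wealth_def using inner_simplex_pos[OF _ R_pos[OF \<omega>]]
      by (intro continuous_intros) force+
    then show ?thesis unfolding exp_utility_def by (cases "\<gamma> = 0") (simp_all add: continuous_intros)
  qed
  have cont: "continuous_on unit_simplex ?E"
  proof (rule continuous_on_sequentiallyI)
    fix q :: "nat \<Rightarrow> real ^ 'd" and p assume q: "\<forall>n. q n \<in> unit_simplex" and p: "p \<in> unit_simplex" and lim: "q \<longlonglongrightarrow> p"
    show "(\<lambda>n. ?E (q n)) \<longlonglongrightarrow> ?E p"
    proof (rule integral_dominated_convergence[OF _ _ w(1)])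
      show "(\<lambda>\<omega>. exp_utility \<gamma> (log_wealth v p (R \<omega>))) \<in> borel_measurable M"
        "(\<lambda>\<omega>. exp_utility \<gamma> (log_wealth v (q n) (R \<omega>))) \<in> borel_measurable M" for n
        using log_wealth_utility_integrable[OF v] p q
        by (auto simp: utility_integrable_def)
      show "AE \<omega> in M. (\<lambda>n. exp_utility \<gamma> (log_wealth v (q n) (R \<omega>)))
          \<longlonglongrightarrow> exp_utility \<gamma> (log_wealth v p (R \<omega>))"
        using pathwise q p lim
        by (intro AE_I2) (auto simp: continuous_on_sequentially o_def)
      show "AE \<omega> in M. norm (exp_utility \<gamma> (log_wealth v (q n) (R \<omega>))) \<le> w \<omega>" for n
        using w(2) q by (intro AE_I2) simp
    qed
  qed
  show ?thesis
  proof (cases "\<gamma> = 0")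
    case True
    have "certainty_equivalent v p = ?E p" for p
      unfolding certainty_equivalent_def entropic_utility_def exp_utility_def using True by simp
    with cont show ?thesis by (simp cong: continuous_on_cong)
  next
    case False
    have pos: "0 < \<gamma> * ?E p" if "p \<in> unit_simplex" for p
      using integral_exp_pos[OF prob_space_axioms utility_integrable_exp[OF prob_space_axioms
          log_wealth_utility_integrable[OF v that]]] False
      by (simp add: exp_utility_def)
    then have "continuous_on unit_simplex (\<lambda>p. 1 / \<gamma> * ln (\<gamma> * ?E p))"
      by (intro continuous_intros cont) force
    then show ?thesis
      using False by (simp add: certainty_equivalent_def[abs_def] entropic_utility_def exp_utility_def)
  qed
qed

end

section \<open>Optimal portfolios\<close>

text \<open>
  The maximisation is over pairs of a scale and a portfolio that respect the budget.  These form a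
  compact set on which the objective is continuous, and enlarging the scale of a maximal
  pair to \<open>shrinkage\<close> can only raise the objective.
\<close>

lemma optimal_portfolio_exists:
  assumes ch: "cost_rates c h" and pi: "\<pi> \<in> unit_simplex" and F: "continuous_on unit_simplex F"
  obtains p where "p \<in> unit_simplex"
    "\<And>q. q \<in> unit_simplex \<Longrightarrow> ln (shrinkage c h \<pi> q) + F q \<le> ln (shrinkage c h \<pi> p) + F p"
proof -
  define B where "B = ({s_bar c h..1} \<times> unit_simplex) \<inter>
    {x. fst x + penalty c h (fst x *\<^sub>R snd x - \<pi>) \<le> 1}"
  have "compact B"
    unfolding B_def
    by (intro compact_Int_closed compact_Times compact_Icc compact_unit_simplex
        closed_Collect_le continuous_intros)
  moreover have shrink_B: "(shrinkage c h \<pi> q, q) \<in> B" if "q \<in> unit_simplex" for q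
    using shrinkage_bounds[OF ch pi that] shrinkage_budget[OF ch pi that] that by (simp add: B_def)
  then have "B \<noteq> {}" using pi by blast
  moreover have "continuous_on B (\<lambda>x. ln (fst x) + F (snd x))"
    using s_bar_bounds(1)[OF ch]
    by (intro continuous_intros continuous_on_compose2[OF F]) (auto simp: B_def)
  ultimately obtain x where x: "x \<in> B" "\<And>y. y \<in> B \<Longrightarrow> ln (fst y) + F (snd y) \<le> ln (fst x) + F (snd x)"
    using continuous_attains_sup[of B "\<lambda>x. ln (fst x) + F (snd x)"] by blast
  show thesis
  proof (rule that)
    show S: "snd x \<in> unit_simplex" using x(1) by (auto simp: B_def)
    have "0 < fst x" using x(1) s_bar_bounds(1)[OF ch] by (auto simp: B_def)
    moreover have "fst x \<le> shrinkage c h \<pi> (snd x)"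
      using x(1) \<open>0 < fst x\<close> by (intro le_shrinkage[OF ch pi S]) (auto simp: B_def)
    ultimately have "ln (fst x) \<le> ln (shrinkage c h \<pi> (snd x))" by simp
    then show "ln (shrinkage c h \<pi> q) + F q \<le> ln (shrinkage c h \<pi> (snd x)) + F (snd x)"
      if "q \<in> unit_simplex" for q
      using x(2)[OF shrink_B[OF that]] by simp
  qed
qed

text \<open>
  Whatever is optimal from \<open>b\<close> can also be reached from \<open>a\<close>, and the two costs of getting there
  differ by at most \<open>- ln s_bar\<close>.
\<close>

lemma value_oscillation:
  fixes c h :: "real ^ 'd"
  assumes ch: "cost_rates c h"
    and v: "\<And>\<pi>. \<pi> \<in> unit_simplex \<Longrightarrow>
      ereal (v \<pi>) = (SUP p\<in>unit_simplex. ereal (ln (shrinkage c h \<pi> p) + F p))"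
    and a: "a \<in> unit_simplex" and b: "b \<in> unit_simplex"
  shows "v a \<le> v b - ln (s_bar c h)"
proof -
  have "ereal (v a) \<le> ereal (v b - ln (s_bar c h))"
    unfolding v[OF a]
  proof (rule SUP_least)
    fix p :: "real ^ 'd" assume p: "p \<in> unit_simplex"
    have "ln (shrinkage c h a p) \<le> 0"
      using shrinkage_bounds(2)[OF ch a p] shrinkage_pos[OF ch a p] by simp
    moreover have "ln (s_bar c h) \<le> ln (shrinkage c h b p)"
      using shrinkage_bounds(1)[OF ch b p] s_bar_bounds(1)[OF ch] by simp
    moreover have "ereal (ln (shrinkage c h b p) + F p) \<le> ereal (v b)"
      unfolding v[OF b] using p by (rule SUP_upper)
    ultimately show "ereal (ln (shrinkage c h a p) + F p) \<le> ereal (v b - ln (s_bar c h))"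
      by simp
  qed
  then show ?thesis by simp
qed

context one_period_market
begin

lemma exp_log_wealth_eq:
  assumes "p \<in> unit_simplex" "\<omega> \<in> space M"
  shows "exp (\<beta> * log_wealth v p (R \<omega>)) = (p \<bullet> R \<omega>) powr \<beta> * exp (\<beta> * v (G p (R \<omega>)))"
proof -
  have "0 < p \<bullet> R \<omega>" by (rule inner_simplex_pos[OF assms(1) R_pos[OF assms(2)]])
  then show ?thesis by (simp add: log_wealth_def powr_def exp_add distrib_left)
qed

text \<open>
  An optimal \<open>p\<close> is compared with the portfolio obtained by selling a little of \<open>p\<close> to buy \<open>b\<close>.
  The sale costs \<open>1 / s_bar\<close> units of \<open>p\<close> per unit of \<open>b\<close>, and superadditivity of the lift bounds
  the new payoff from below by a proportional perturbation of the old one, with \<open>Z\<close> the ratio of the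
  payoffs of \<open>b\<close> and \<open>p\<close>.
\<close>

lemma asset_first_order_condition:
  assumes ch: "cost_rates c h" and v: "v \<in> Cb_simplex"
    and conc: "concave_on nonneg_orthant (lift v)"
    and pi: "\<pi> \<in> unit_simplex" and p: "p \<in> unit_simplex" and b: "b \<in> unit_simplex"
    and opt: "\<And>q. q \<in> unit_simplex \<Longrightarrow>
      ln (shrinkage c h \<pi> q) + certainty_equivalent v q \<le> ln (shrinkage c h \<pi> p) + certainty_equivalent v p"
  shows "(\<integral>\<^sup>+\<omega>. ennreal (exp (log_wealth v b (R \<omega>)) * exp ((\<gamma> - 1) * log_wealth v p (R \<omega>))) \<partial>M)
    \<le> ennreal (1 / s_bar c h) * (\<integral>\<^sup>+\<omega>. ennreal (exp (\<gamma> * log_wealth v p (R \<omega>))) \<partial>M)"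
proof -
  define X0 where "X0 \<omega> = log_wealth v p (R \<omega>)" for \<omega>
  define Z where "Z \<omega> = exp (log_wealth v b (R \<omega>) - X0 \<omega>)" for \<omega>
  have sb: "0 < s_bar c h" by (rule s_bar_bounds[OF ch])
  note M = prob_space_axioms
  have X0: "utility_integrable M \<gamma> X0"
    unfolding X0_def by (rule log_wealth_utility_integrable[OF v p])
  have Z: "Z \<in> borel_measurable M"
    unfolding Z_def X0_def using log_wealth_measurable[OF v p] log_wealth_measurable[OF v b]
    by (intro borel_measurable_exp[THEN measurable_compose[rotated]] borel_measurable_diff)
  have "(\<integral>\<^sup>+\<omega>. ennreal (Z \<omega> * exp (\<gamma> * X0 \<omega>)) \<partial>M)
      \<le> ennreal (1 / s_bar c h) * (\<integral>\<^sup>+\<omega>. ennreal (exp (\<gamma> * X0 \<omega>)) \<partial>M)"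
  proof (rule entropic_first_order_condition[OF M X0 Z])
    fix \<delta> :: real assume "0 < \<delta>" "\<delta> < 1 / (1 / s_bar c h)"
    then have \<delta>: "0 < \<delta>" "\<delta> < s_bar c h" by auto
    define y where "y = (1 - \<delta> / s_bar c h) *\<^sub>R p + \<delta> *\<^sub>R b"
    have y: "0 < y \<bullet> 1" "y /\<^sub>R (y \<bullet> 1) \<in> unit_simplex"
      and shrink: "shrinkage c h \<pi> p * (y \<bullet> 1) \<le> shrinkage c h \<pi> (y /\<^sub>R (y \<bullet> 1))"
      using shrinkage_rebalance[OF ch pi p b \<delta>] unfolding y_def by auto
    define X where "X \<omega> = log_wealth v (y /\<^sub>R (y \<bullet> 1)) (R \<omega>) + ln (y \<bullet> 1)" for \<omega>
    have int: "utility_integrable M \<gamma> (\<lambda>\<omega>. log_wealth v (y /\<^sub>R (y \<bullet> 1)) (R \<omega>))"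
      by (rule log_wealth_utility_integrable[OF v y(2)])
    have "utility_integrable M \<gamma> X"
      unfolding X_def by (rule utility_integrable_add_const[OF M int])
    moreover have "entropic_utility M \<gamma> X \<le> entropic_utility M \<gamma> X0"
    proof -
      have "ln (shrinkage c h \<pi> p) + ln (y \<bullet> 1) = ln (shrinkage c h \<pi> p * (y \<bullet> 1))"
        using y(1) shrinkage_pos[OF ch pi p] by (simp add: ln_mult)
      also have "\<dots> \<le> ln (shrinkage c h \<pi> (y /\<^sub>R (y \<bullet> 1)))"
        using y(1) shrinkage_pos[OF ch pi p] by (intro ln_mono shrink) simp
      finally show ?thesis
        using opt[OF y(2)] entropic_utility_add_const[OF M int, of "ln (y \<bullet> 1)"]
        unfolding X_def X0_def certainty_equivalent_def by linarith
    qed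
    moreover have "X0 \<omega> + ln (1 + \<delta> * (Z \<omega> - 1 / s_bar c h)) \<le> X \<omega>" if \<omega>: "\<omega> \<in> space M" for \<omega>
    proof -
      have frac: "0 < 1 - \<delta> / s_bar c h" using \<delta> sb by simp
      have "0 < \<delta> * Z \<omega>" using \<delta> by (simp add: Z_def)
      then have pos: "0 < 1 + \<delta> * (Z \<omega> - 1 / s_bar c h)"
        using frac by (simp add: algebra_simps)
      have Zx: "exp (X0 \<omega>) * Z \<omega> = exp (log_wealth v b (R \<omega>))"
        by (simp add: Z_def exp_diff)
      have "exp (X0 \<omega> + ln (1 + \<delta> * (Z \<omega> - 1 / s_bar c h)))
          = (1 - \<delta> / s_bar c h) * exp (X0 \<omega>) + \<delta> * (exp (X0 \<omega>) * Z \<omega>)"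
        using pos by (simp add: exp_add algebra_simps)
      also have "\<dots> \<le> exp (X \<omega>)"
        unfolding Zx unfolding X_def X0_def y_def
        using frac \<delta> y unfolding y_def
        by (intro log_wealth_mix[OF conc p b R_pos[OF \<omega>]]) auto
      finally show ?thesis by simp
    qed
    ultimately show "\<exists>X. utility_integrable M \<gamma> X \<and>
        entropic_utility M \<gamma> X \<le> entropic_utility M \<gamma> X0 \<and>
        (\<forall>\<omega>\<in>space M. X0 \<omega> + ln (1 + \<delta> * (Z \<omega> - 1 / s_bar c h)) \<le> X \<omega>)"
      by blast
  qed (use sb in \<open>auto simp: Z_def\<close>)
  moreover have "Z \<omega> * exp (\<gamma> * X0 \<omega>) = exp (log_wealth v b (R \<omega>)) * exp ((\<gamma> - 1) * X0 \<omega>)" for \<omega>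
    by (simp add: Z_def exp_add[symmetric] algebra_simps)
  ultimately show ?thesis by (simp add: X0_def)
qed

text \<open>
  If the optimal portfolio left out asset \<open>i\<close>, the first-order condition for buying it would bound
  its weighted expected return.  Estimating \<open>v\<close> by its minimum \<open>v a\<close> turns this bound into the
  negation of the growth condition.  In the numerator the wealth of \<open>p\<close> has the exponent
  \<open>\<gamma> - 1 < 0\<close>, so an upper estimate \<open>v a - ln s_bar\<close> is needed there, and it produces the factor
  \<open>s_bar powr (\<gamma> - 1)\<close>; the payoff of asset \<open>i\<close>, and the denominator with its exponent
  \<open>\<gamma> \<le> 0\<close>, are estimated by \<open>v a\<close> itself, so that no further loss occurs.
\<close>

lemma optimal_portfolio_interior:
  assumes ch: "cost_rates c h" and v: "v \<in> Cb_simplex"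
    and conc: "concave_on nonneg_orthant (lift v)"
    and osc: "\<And>a b. a \<in> unit_simplex \<Longrightarrow> b \<in> unit_simplex \<Longrightarrow> v a \<le> v b - ln (s_bar c h)"
    and growth: "\<And>i p. p \<in> unit_simplex \<Longrightarrow> p $ i = 0 \<Longrightarrow>
      ennreal (s_bar c h powr (\<gamma> - 1) * (1 / s_bar c h))
        < (\<integral>\<^sup>+\<omega>. ennreal (R \<omega> $ i * (p \<bullet> R \<omega>) powr (\<gamma> - 1)) \<partial>M) / (\<integral>\<^sup>+\<omega>. ennreal ((p \<bullet> R \<omega>) powr \<gamma>) \<partial>M)"
    and pi: "\<pi> \<in> unit_simplex" and p: "p \<in> unit_simplex"
    and opt: "\<And>q. q \<in> unit_simplex \<Longrightarrow>
      ln (shrinkage c h \<pi> q) + certainty_equivalent v q \<le> ln (shrinkage c h \<pi> p) + certainty_equivalent v p"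
  shows "p \<in> unit_simplex_pos"
proof (rule ccontr)
  assume "p \<notin> unit_simplex_pos"
  then obtain i where i: "p $ i = 0"
    using p by (auto simp: unit_simplex_pos_def unit_simplex_def not_less intro: antisym)
  define N where "N = (\<integral>\<^sup>+\<omega>. ennreal (R \<omega> $ i * (p \<bullet> R \<omega>) powr (\<gamma> - 1)) \<partial>M)"
  define D where "D = (\<integral>\<^sup>+\<omega>. ennreal ((p \<bullet> R \<omega>) powr \<gamma>) \<partial>M)"
  have sb: "0 < s_bar c h" by (rule s_bar_bounds[OF ch])
  have [measurable]: "(\<lambda>\<omega>. p \<bullet> R \<omega>) \<in> borel_measurable M" by measurable
  obtain a where a: "a \<in> unit_simplex" "\<And>x. x \<in> unit_simplex \<Longrightarrow> v a \<le> v x"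
    using continuous_attains_inf[OF compact_unit_simplex unit_simplex_nonempty, of v] v
    by (auto simp: Cb_simplex_def)
  let ?e = "axis i 1 :: real ^ 'd"
  define k where "k = exp (v a + (\<gamma> - 1) * (v a - ln (s_bar c h)))"
  have G: "G p (R \<omega>) \<in> unit_simplex" if "\<omega> \<in> space M" for \<omega>
    by (rule G_in_unit_simplex[OF p R_pos[OF that]])
  have "ennreal k * N = (\<integral>\<^sup>+\<omega>. ennreal (k * (R \<omega> $ i * (p \<bullet> R \<omega>) powr (\<gamma> - 1))) \<partial>M)"
    unfolding N_def k_def by (subst nn_integral_cmult[symmetric]) (auto simp: ennreal_mult')
  also have "\<dots> \<le> (\<integral>\<^sup>+\<omega>. ennreal (exp (log_wealth v ?e (R \<omega>)) * exp ((\<gamma> - 1) * log_wealth v p (R \<omega>))) \<partial>M)"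
  proof (rule nn_integral_mono, rule ennreal_leI)
    fix \<omega> assume \<omega>: "\<omega> \<in> space M"
    have "k \<le> exp (v (G ?e (R \<omega>)) + (\<gamma> - 1) * v (G p (R \<omega>)))"
      unfolding k_def exp_le_cancel_iff
    proof (intro add_mono mult_left_mono_neg)
      show "v a \<le> v (G ?e (R \<omega>))"
        by (intro a(2) G_in_unit_simplex axis_in_unit_simplex R_pos \<omega>)
      show "v (G p (R \<omega>)) \<le> v a - ln (s_bar c h)" by (rule osc[OF G[OF \<omega>] a(1)])
    qed (use \<gamma>_nonpos in simp)
    then have "k * (R \<omega> $ i * (p \<bullet> R \<omega>) powr (\<gamma> - 1))
        \<le> exp (v (G ?e (R \<omega>)) + (\<gamma> - 1) * v (G p (R \<omega>))) * (R \<omega> $ i * (p \<bullet> R \<omega>) powr (\<gamma> - 1))"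
      using R_pos[OF \<omega>, of i] by (intro mult_right_mono) auto
    also have "\<dots> = exp (log_wealth v ?e (R \<omega>)) * exp ((\<gamma> - 1) * log_wealth v p (R \<omega>))"
      unfolding exp_log_wealth_eq[OF p \<omega>] using R_pos[OF \<omega>, of i]
      by (simp add: log_wealth_def inner_axis' exp_add)
    finally show "k * (R \<omega> $ i * (p \<bullet> R \<omega>) powr (\<gamma> - 1)) \<le> \<dots>" .
  qed
  also have "\<dots> \<le> ennreal (1 / s_bar c h) * (\<integral>\<^sup>+\<omega>. ennreal (exp (\<gamma> * log_wealth v p (R \<omega>))) \<partial>M)"
    by (rule asset_first_order_condition[OF ch v conc pi p axis_in_unit_simplex opt])
  also have "\<dots> \<le> ennreal (1 / s_bar c h) * (ennreal (exp (\<gamma> * v a)) * D)"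
  proof (rule mult_left_mono)
    have "(\<integral>\<^sup>+\<omega>. ennreal (exp (\<gamma> * log_wealth v p (R \<omega>))) \<partial>M)
        \<le> (\<integral>\<^sup>+\<omega>. ennreal (exp (\<gamma> * v a)) * ennreal ((p \<bullet> R \<omega>) powr \<gamma>) \<partial>M)"
    proof (rule nn_integral_mono)
      fix \<omega> assume \<omega>: "\<omega> \<in> space M"
      have "exp (\<gamma> * v (G p (R \<omega>))) \<le> exp (\<gamma> * v a)"
        using a(2)[OF G[OF \<omega>]] \<gamma>_nonpos by (simp add: mult_left_mono_neg)
      then show "ennreal (exp (\<gamma> * log_wealth v p (R \<omega>)))
          \<le> ennreal (exp (\<gamma> * v a)) * ennreal ((p \<bullet> R \<omega>) powr \<gamma>)"
        unfolding exp_log_wealth_eq[OF p \<omega>]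
        by (subst ennreal_mult[symmetric])
          (auto intro!: ennreal_leI mult_left_mono simp: mult.commute[of "exp (\<gamma> * v a)"])
    qed
    also have "\<dots> = ennreal (exp (\<gamma> * v a)) * D"
      unfolding D_def by (rule nn_integral_cmult) measurable
    finally show "(\<integral>\<^sup>+\<omega>. ennreal (exp (\<gamma> * log_wealth v p (R \<omega>))) \<partial>M) \<le> ennreal (exp (\<gamma> * v a)) * D" .
  qed simp
  also have "\<dots> = ennreal (1 / s_bar c h * exp (\<gamma> * v a)) * D"
    using sb by (subst ennreal_mult) (auto simp only: mult.assoc divide_nonneg_pos exp_ge_zero zero_le_one)
  finally have kN: "ennreal k * N \<le> ennreal (1 / s_bar c h * exp (\<gamma> * v a)) * D" .
  have k_eq: "1 / s_bar c h * exp (\<gamma> * v a) = k * (s_bar c h powr (\<gamma> - 1) * (1 / s_bar c h))"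
  proof -
    have "k * s_bar c h powr (\<gamma> - 1) = exp (\<gamma> * v a)"
      using sb by (simp add: k_def powr_def exp_add[symmetric] algebra_simps)
    then show ?thesis by (simp add: mult.assoc[symmetric])
  qed
  define L where "L = s_bar c h powr (\<gamma> - 1) * (1 / s_bar c h)"
  have L: "0 \<le> L" and k: "0 < k" using sb by (simp_all add: L_def k_def)
  have "ennreal k * N \<le> ennreal k * (ennreal L * D)"
    using kN k L unfolding k_eq L_def[symmetric] by (simp add: ennreal_mult mult.assoc)
  then have "N \<le> ennreal L * D"
    using k by (subst (asm) ennreal_mult_le_mult_iff) auto
  then have "N / D \<le> ennreal L"
    by (cases "D = 0") (auto intro!: divide_le_posI_ennreal simp: mult.commute zero_less_iff_neq_zero)
  with growth[OF p i] show False by (simp add: N_def D_def L_def not_less[symmetric])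
qed

end

section \<open>Uniqueness\<close>

context one_period_market
begin

text \<open>
  At a maximum point \<open>a\<close> of \<open>v1 - v2\<close>, the first Bellman equation is attained at some portfolio
  \<open>p\<close>, and in the second one \<open>p\<close> is admissible.  Subtracting removes the transaction cost, and
  the certainty equivalents of \<open>p\<close> differ by at least the maximum, although pathwise the wealths
  differ by at most that.
\<close>

lemma bellman_difference_AE_max:
  assumes ch: "cost_rates c h" and v1: "v1 \<in> Cb_simplex" and v2: "v2 \<in> Cb_simplex"
    and B1: "\<And>\<pi>. \<pi> \<in> unit_simplex \<Longrightarrow> ereal (v1 \<pi>) =
      (SUP p\<in>unit_simplex. ereal (ln (shrinkage c h \<pi> p) + (certainty_equivalent v1 p - k)))"
    and B2: "\<And>\<pi>. \<pi> \<in> unit_simplex \<Longrightarrow> ereal (v2 \<pi>) =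
      (SUP p\<in>unit_simplex. ereal (ln (shrinkage c h \<pi> p) + (certainty_equivalent v2 p - k)))"
    and conc: "concave_on nonneg_orthant (lift v1)"
    and growth: "\<And>i p. p \<in> unit_simplex \<Longrightarrow> p $ i = 0 \<Longrightarrow>
      ennreal (s_bar c h powr (\<gamma> - 1) * (1 / s_bar c h))
        < (\<integral>\<^sup>+\<omega>. ennreal (R \<omega> $ i * (p \<bullet> R \<omega>) powr (\<gamma> - 1)) \<partial>M) / (\<integral>\<^sup>+\<omega>. ennreal ((p \<bullet> R \<omega>) powr \<gamma>) \<partial>M)"
  obtains p m where "p \<in> unit_simplex_pos" "AE \<omega> in M. v1 (G p (R \<omega>)) = v2 (G p (R \<omega>)) + m"
proof -
  have "continuous_on unit_simplex (\<lambda>x. v1 x - v2 x)"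
    using v1 v2 by (intro continuous_intros) (auto simp: Cb_simplex_def)
  then obtain a where a: "a \<in> unit_simplex"
    and max: "\<And>x. x \<in> unit_simplex \<Longrightarrow> v1 x - v2 x \<le> v1 a - v2 a"
    using continuous_attains_sup[OF compact_unit_simplex unit_simplex_nonempty, of "\<lambda>x. v1 x - v2 x"]
    by blast
  define m where "m = v1 a - v2 a"
  obtain p where p: "p \<in> unit_simplex" and opt: "\<And>q. q \<in> unit_simplex \<Longrightarrow>
      ln (shrinkage c h a q) + certainty_equivalent v1 q \<le> ln (shrinkage c h a p) + certainty_equivalent v1 p"
    using optimal_portfolio_exists[OF ch a continuous_on_certainty_equivalent[OF v1]] by blast
  have "p \<in> unit_simplex_pos"
    by (rule optimal_portfolio_interior[OF ch v1 conc value_oscillation[OF ch B1] growth a p opt])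
  moreover have "AE \<omega> in M. v1 (G p (R \<omega>)) = v2 (G p (R \<omega>)) + m"
  proof -
    have int: "utility_integrable M \<gamma> (\<lambda>\<omega>. log_wealth v p (R \<omega>))" if "v \<in> Cb_simplex" for v
      by (rule log_wealth_utility_integrable[OF that p])
    have "ereal (v1 a) \<le> ereal (ln (shrinkage c h a p) + (certainty_equivalent v1 p - k))"
      unfolding B1[OF a] using opt by (intro SUP_least) (simp add: add_diff_eq)
    moreover have "ereal (ln (shrinkage c h a p) + (certainty_equivalent v2 p - k)) \<le> ereal (v2 a)"
      unfolding B2[OF a] using p by (rule SUP_upper)
    ultimately have "certainty_equivalent v2 p + m \<le> certainty_equivalent v1 p"
      by (simp add: m_def)
    then have ce: "entropic_utility M \<gamma> (\<lambda>\<omega>. log_wealth v2 p (R \<omega>) + m)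
        \<le> entropic_utility M \<gamma> (\<lambda>\<omega>. log_wealth v1 p (R \<omega>))"
      unfolding certainty_equivalent_def entropic_utility_add_const[OF prob_space_axioms int[OF v2]] .
    have le: "log_wealth v1 p (R \<omega>) \<le> log_wealth v2 p (R \<omega>) + m" if "\<omega> \<in> space M" for \<omega>
      using max[OF G_in_unit_simplex[OF p R_pos[OF that]]] by (simp add: log_wealth_def m_def)
    have "AE \<omega> in M. log_wealth v1 p (R \<omega>) = log_wealth v2 p (R \<omega>) + m"
      by (rule entropic_utility_eq_AE[OF prob_space_axioms int[OF v1]
            utility_integrable_add_const[OF prob_space_axioms int[OF v2]] le ce])
    then show ?thesis by eventually_elim (simp add: log_wealth_def)
  qed
  ultimately show thesis by (rule that)
qed

end

text \<open>
  Full support concerns fixed times, so the almost sure identity is first carried over from the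
  random time to some fixed \<open>t > 0\<close>.  There the relatively open set on which \<open>f\<close> differs from \<open>m\<close>
  is avoided almost surely, hence empty.
\<close>

lemma constant_from_full_support:
  fixes S :: "real \<Rightarrow> 'a \<Rightarrow> real ^ 'd"
  assumes market: "market M S \<eta>" and incr: "increments_assm M S" and full: "full_support_assm M S"
    and f: "continuous_on unit_simplex f"
    and p: "p \<in> unit_simplex_pos" and ae: "AE \<omega> in M. f (G p (ratio S (\<eta> 1 \<omega>) \<omega>)) = (m :: real)"
    and x: "x \<in> unit_simplex"
  shows "f x = m"
proof -
  interpret prob_space M using market by (simp add: market_def)
  \<comment> \<open>Multiplying by the indicator of the simplex makes the function Borel on the whole space.\<close>
  define g where "g x = indicator unit_simplex x *\<^sub>R (f x - m)" for x
  have [measurable]: "g \<in> borel_measurable borel"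
    unfolding g_def[abs_def] using f compact_imp_closed[OF compact_unit_simplex]
    by (intro borel_measurable_continuous_on_indicator borel_closed continuous_intros)
  have [measurable]: "(\<lambda>x. G p x) \<in> borel_measurable borel"
    unfolding G_def times_vec_def by measurable
  have "{x \<in> space borel. g (G p x) = 0} \<in> sets borel" by measurable
  then have "{x. g (G p x) = 0} \<in> sets borel" by simp
  moreover have "AE \<omega> in M. g (G p (ratio S (\<eta> 1 \<omega>) \<omega>)) = 0"
    using ae by eventually_elim (simp add: g_def)
  ultimately obtain t where t: "0 < t" "AE \<omega> in M. g (G p (ratio S t \<omega>)) = 0"
    using AE_ratio_at_fixed_time[OF market incr, of "\<lambda>x. g (G p x) = 0"] by blast
  define C where "C = {x \<in> unit_simplex. f x \<noteq> m}"
  have "openin (top_of_set unit_simplex) (unit_simplex \<inter> f -` (- {m}))"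
    by (rule continuous_openin_preimage_gen[OF f]) auto
  moreover have "unit_simplex \<inter> f -` (- {m}) = C" by (auto simp: C_def)
  ultimately have open_C: "openin (top_of_set unit_simplex) C" by simp
  have "AE \<omega> in M. G p (ratio S t \<omega>) \<notin> C"
    using t(2) by eventually_elim (auto simp: g_def C_def)
  then have null: "measure M {\<omega> \<in> space M. G p (ratio S t \<omega>) \<in> C} = 0"
    by (rule prob_eq_0_AE)
  have "C = {}"
  proof (rule ccontr)
    assume "C \<noteq> {}"
    then have "0 < measure M {\<omega> \<in> space M. G p (ratio S t \<omega>) \<in> C}"
      using full p t(1) open_C unfolding full_support_assm_def by blast
    with null show False by simp
  qed
  then show ?thesis using x by (auto simp: C_def)
qed

theorem theorem3p17:
  fixes M :: "'a measure"
    and S :: "real \<Rightarrow> 'a \<Rightarrow> real ^ 'd"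
    and \<eta> :: "nat \<Rightarrow> 'a \<Rightarrow> real"
    and c h :: "real ^ 'd"
    and \<gamma> lambda_bar :: real
    and v1 v2 :: "real ^ 'd \<Rightarrow> real"
  assumes "cost_rates c h"
    and "market M S \<eta>"
    and "increments_assm M S"
    and "waiting_assm M \<eta>"
    and "integrability_assm M S \<eta>"
    and "full_support_assm M S"
    and "growth_assm M c h S \<eta>"
    and "\<gamma> \<le> 0"
    and "v1 \<in> Cb_simplex" and "v2 \<in> Cb_simplex"
    and "bellman_solution M c h S \<eta> \<gamma> lambda_bar v1"
    and "bellman_solution M c h S \<eta> \<gamma> lambda_bar v2"
    and "concave_on nonneg_orthant (lift v1)"
    and "concave_on nonneg_orthant (lift v2)"
  shows "\<exists>D::real. \<forall>\<pi>\<in>unit_simplex. v1 \<pi> = v2 \<pi> + D"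
proof -
  note ch = assms(1) and market = assms(2) and incr = assms(3) and full = assms(6)
    and v = assms(9,10)
  interpret prob_space M using market by (simp add: market_def)
  define R where "R \<omega> = ratio S (\<eta> 1 \<omega>) \<omega>" for \<omega>
  have pos: "0 < S t \<omega> $ i" if "\<omega> \<in> space M" "0 \<le> t" for \<omega> t i
    using market that by (simp add: market_def)
  have \<eta>_pos: "0 < \<eta> 1 \<omega>" if "\<omega> \<in> space M" for \<omega>
    using market that by (simp add: market_def)
  have \<eta>_meas: "\<eta> 1 \<in> borel_measurable M"
    using market by (auto simp: market_def indep_vars_def)
  interpret one_period_market M R \<gamma>
  proof
    show "R \<in> borel_measurable M"
      unfolding R_def using market incr \<eta>_pos
      by (intro measurable_ratio_at_time \<eta>_meas)
        (auto simp: market_def increments_assm_def less_imp_le)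
    show "0 < R \<omega> $ i" if "\<omega> \<in> space M" for \<omega> i
      using pos[OF that] \<eta>_pos[OF that] by (simp add: R_def price_ratio_def)
    show "(\<integral>\<^sup>+\<omega>. ennreal (exp (\<beta> * Min (range (\<lambda>i. ln (R \<omega> $ i))))) \<partial>M) < \<infinity>" if "\<beta> < 0" for \<beta>
      using assms(5) that by (simp add: integrability_assm_def log_ratio_def R_def)
    show "(\<integral>\<^sup>+\<omega>. ennreal (Max (range (\<lambda>i. ln (R \<omega> $ i)))) \<partial>M) < \<infinity>"
      using assms(5) by (simp add: integrability_assm_def log_ratio_def R_def)
  qed (fact assms(8))
  define k where "k = lambda_bar * (\<integral>\<omega>. \<eta> 1 \<omega> \<partial>M)"
  have B: "ereal (w \<pi>) =
      (SUP p\<in>unit_simplex. ereal (ln (shrinkage c h \<pi> p) + (certainty_equivalent w p - k)))"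
    if "bellman_solution M c h S \<eta> \<gamma> lambda_bar w" "\<pi> \<in> unit_simplex" for w \<pi>
    using that unfolding bellman_solution_def certainty_equivalent_def log_wealth_def k_def R_def
    by (simp add: algebra_simps)
  have growth: "ennreal (s_bar c h powr (\<gamma> - 1) * (1 / s_bar c h))
        < (\<integral>\<^sup>+\<omega>. ennreal (R \<omega> $ i * (p \<bullet> R \<omega>) powr (\<gamma> - 1)) \<partial>M) / (\<integral>\<^sup>+\<omega>. ennreal ((p \<bullet> R \<omega>) powr \<gamma>) \<partial>M)"
    if "p \<in> unit_simplex" "p $ i = 0" for i p
  proof (rule le_less_trans)
    show "ennreal (s_bar c h powr (\<gamma> - 1) * (1 / s_bar c h))
        \<le> ennreal (s_bar c h powr (\<gamma> - 1) * (1 + 2 * (c_bar c h / (1 - c_bar c h)) / s_bar c h))"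
      by (intro ennreal_leI mult_left_mono inverse_s_bar_le_growth_threshold ch) simp
    show "\<dots> < (\<integral>\<^sup>+\<omega>. ennreal (R \<omega> $ i * (p \<bullet> R \<omega>) powr (\<gamma> - 1)) \<partial>M)
        / (\<integral>\<^sup>+\<omega>. ennreal ((p \<bullet> R \<omega>) powr \<gamma>) \<partial>M)"
      using assms(7,8) that unfolding growth_assm_def Let_def R_def by blast
  qed
  obtain p m where p: "p \<in> unit_simplex_pos"
    and ae: "AE \<omega> in M. v1 (G p (R \<omega>)) = v2 (G p (R \<omega>)) + m"
    using bellman_difference_AE_max[OF ch v B[OF assms(11)] B[OF assms(12)] assms(13) growth] by blast
  have "v1 \<pi> - v2 \<pi> = m" if "\<pi> \<in> unit_simplex" for \<pi>
  proof (rule constant_from_full_support[OF market incr full _ p _ that])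
    show "continuous_on unit_simplex (\<lambda>x. v1 x - v2 x)"
      using v by (intro continuous_intros) (auto simp: Cb_simplex_def)
    show "AE \<omega> in M. v1 (G p (ratio S (\<eta> 1 \<omega>) \<omega>)) - v2 (G p (ratio S (\<eta> 1 \<omega>) \<omega>)) = m"
      using ae by eventually_elim (simp add: R_def)
  qed
  then show ?thesis by (intro exI[of _ m]) force
qed

end
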